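(* Let $1/2<s\le 1$, let $u_0$ be smooth and $2\pi$-periodic, and let $u^{N}$ be the solution of the semidiscrete problem $\frac{d}{dt}u^{N}=F(u^{N})$, $0\le t\le T$, $u^{N}(0)=P_Nu_0$. With $I_1=I_1(u^N(0))$, $E=H(u^N(0))$ and $C_\infty=\big(\sum_{k=-\infty}^{\infty}\frac{1}{1+|k|^{2s}}\big)^{1/2}$, assume that $C_*:=1-C_\infty^2I_1>0$ and $\frac{I_1}{2}+E\ge 0$. Assume that the solution $u$ of the periodic problem $iu_t-(-\partial_{xx})^su+|u|^2u=0$, $u(x,0)=u_0(x)$, is in $H^{\mu}$, $\mu>s$, for $t\in[0,T]$, with $\sup_{0\le t\le T}\|u(t)\|_\mu<\infty$. Given nonnegative integers $j$ and $l$, and provided $\mu\ge\max\{2,2sj+l\}$, there is a constant $C$, independent of $N$, such that $$\max_{0\le t\le T}\|\partial_t^{j}u^{N}(t)\|_{l}\le C .$$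
   Context: $T>0$ is fixed. All functions are complex-valued and $2\pi$-periodic in $x$; $L^2=L^2(-\pi,\pi)$ with $(u_1,u_2)=\int_{-\pi}^{\pi}u_1\overline{u_2}\,dx$. $\widehat u(k)=\frac1{2\pi}\int_{-\pi}^{\pi}u(x)e^{-ikx}dx$. For $\mu\ge0$, $H^\mu$ is the periodic Sobolev space with norm $\|u\|_\mu=(\sum_{k\in\mathbb Z}(1+k^2)^\mu|\widehat u(k)|^2)^{1/2}$. $(-\partial_{xx})^{s}$ is the Fourier multiplier with symbol $|k|^{2s}$, $|D|^s=(-\partial_{xx})^{s/2}$. $N\ge1$ is an integer, $S_N=\mathrm{span}\{e^{ikx}:-N\le k\le N\}$, $P_Nu=\sum_{|k|\le N}\widehat u(k)e^{ikx}$. $F:S_N\to S_N$ is $F(u)=-i(-\partial_{xx})^su+iP_N(|u|^2u)$, so that $u^N:[0,T]\to S_N$ satisfies $(iu^N_t-(-\partial_{xx})^su^N+|u^N|^2u^N,\varphi)=0$ for all $\varphi\in S_N$. $I_1(u)=\frac12\int_{-\pi}^{\pi}|u|^2dx$, $H(u)=\frac12\int_{-\pi}^{\pi}\big(||D|^su|^2-\frac12|u|^4\big)dx$. *)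

theory Defs
  imports "HOL-Analysis.Analysis"
begin

definition periodic :: "(real \<Rightarrow> complex) \<Rightarrow> bool" where
  "periodic u \<longleftrightarrow> (\<forall>x. u (x + 2 * pi) = u x)"

definition smooth :: "(real \<Rightarrow> complex) \<Rightarrow> bool" where
  "smooth u \<longleftrightarrow> (\<exists>D :: nat \<Rightarrow> real \<Rightarrow> complex. D 0 = u \<and>
     (\<forall>n x. (D n has_vector_derivative D (Suc n) x) (at x)))"

definition expo :: "int \<Rightarrow> real \<Rightarrow> complex" where
  "expo k x = exp (\<i> * of_int k * of_real x)"

definition fourier :: "(real \<Rightarrow> complex) \<Rightarrow> int \<Rightarrow> complex" where
  "fourier u k = of_real (1 / (2 * pi)) *
     (LINT x:{-pi..pi}|lebesgue. u x * expo (- k) x)"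

definition sobolev_norm :: "real \<Rightarrow> (real \<Rightarrow> complex) \<Rightarrow> real" where
  "sobolev_norm \<mu> u =
     sqrt (\<Sum>\<^sub>\<infinity>k. (1 + (real_of_int k)\<^sup>2) powr \<mu> * (cmod (fourier u k))\<^sup>2)"

text \<open>Elements of the periodic Sobolev space are represented by periodic functions, not by
  classes modulo null sets. Summability is required explicitly, because \<^const>\<open>infsum\<close> is \<open>0\<close>
  on families that are not summable.\<close>

definition Sobolev :: "real \<Rightarrow> (real \<Rightarrow> complex) set" where
  "Sobolev \<mu> = {u. periodic u \<and> u \<in> borel_measurable lebesgue \<and>
     set_integrable lebesgue {-pi..pi} (\<lambda>x. (cmod (u x))\<^sup>2) \<and>
     (\<lambda>k. (1 + (real_of_int k)\<^sup>2) powr \<mu> * (cmod (fourier u k))\<^sup>2) summable_on UNIV}"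

text \<open>The multiplier with symbol \<open>\<bar>k\<bar>\<^sup>2\<^sup>s\<close>, given by its Fourier series. It is only applied to
  trigonometric polynomials, for which the series is a finite sum.\<close>

definition frac_lap :: "real \<Rightarrow> (real \<Rightarrow> complex) \<Rightarrow> real \<Rightarrow> complex" where
  "frac_lap s u x =
     (\<Sum>\<^sub>\<infinity>k. of_real (\<bar>real_of_int k\<bar> powr (2 * s)) * fourier u k * expo k x)"

definition abs_D :: "real \<Rightarrow> (real \<Rightarrow> complex) \<Rightarrow> real \<Rightarrow> complex" where
  "abs_D s = frac_lap (s / 2)"

definition trig_space :: "nat \<Rightarrow> (real \<Rightarrow> complex) set" where
  "trig_space N = {u. \<exists>c :: int \<Rightarrow> complex. u = (\<lambda>x. \<Sum>k\<in>{- int N..int N}. c k * expo k x)}"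

definition trig_proj :: "nat \<Rightarrow> (real \<Rightarrow> complex) \<Rightarrow> real \<Rightarrow> complex" where
  "trig_proj N u x = (\<Sum>k\<in>{- int N..int N}. fourier u k * expo k x)"

definition cubic :: "(real \<Rightarrow> complex) \<Rightarrow> real \<Rightarrow> complex" where
  "cubic u x = of_real ((cmod (u x))\<^sup>2) * u x"

definition galerkin_rhs :: "real \<Rightarrow> nat \<Rightarrow> (real \<Rightarrow> complex) \<Rightarrow> real \<Rightarrow> complex" where
  "galerkin_rhs s N u x = - \<i> * frac_lap s u x + \<i> * trig_proj N (cubic u) x"

definition mass :: "(real \<Rightarrow> complex) \<Rightarrow> real" where
  "mass u = 1/2 * (LINT x:{-pi..pi}|lebesgue. (cmod (u x))\<^sup>2)"

definition energy :: "real \<Rightarrow> (real \<Rightarrow> complex) \<Rightarrow> real" where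
  "energy s u = 1/2 * (LINT x:{-pi..pi}|lebesgue.
     (cmod (abs_D s u x))\<^sup>2 - 1/2 * (cmod (u x)) ^ 4)"

definition C_infty :: "real \<Rightarrow> real" where
  "C_infty s = sqrt (\<Sum>\<^sub>\<infinity>k::int. 1 / (1 + \<bar>real_of_int k\<bar> powr (2 * s)))"

text \<open>Functions of time and space are written \<open>v t x\<close>; only times in \<open>{0..T}\<close> matter, and time
  derivatives at \<open>0\<close> and \<open>T\<close> are one-sided. For curves in the finite-dimensional space
  \<open>trig_space N\<close>, the time derivative in that space is the pointwise one.\<close>

definition time_deriv :: "real \<Rightarrow> (real \<Rightarrow> real \<Rightarrow> complex) \<Rightarrow> real \<Rightarrow> real \<Rightarrow> complex" where
  "time_deriv T v t x = vector_derivative (\<lambda>\<tau>. v \<tau> x) (at t within {0..T})"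

definition galerkin_solution ::
  "real \<Rightarrow> real \<Rightarrow> nat \<Rightarrow> (real \<Rightarrow> complex) \<Rightarrow> (real \<Rightarrow> real \<Rightarrow> complex) \<Rightarrow> bool" where
  "galerkin_solution s T N u0 v \<longleftrightarrow>
     v 0 = trig_proj N u0 \<and>
     (\<forall>t\<in>{0..T}. v t \<in> trig_space N) \<and>
     (\<forall>t\<in>{0..T}. \<forall>x.
        ((\<lambda>\<tau>. v \<tau> x) has_vector_derivative galerkin_rhs s N (v t) x) (at t within {0..T}))"

text \<open>The equation \<open>i u\<^sub>t - (-\<partial>\<^sub>x\<^sub>x)\<^sup>s u + |u|\<^sup>2 u = 0\<close> is understood in the sense of periodic
  distributions in \<open>x\<close>, that is, tested against every \<open>expo k\<close>: for \<open>u t\<close> of limited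
  Sobolev regularity, \<open>(-\<partial>\<^sub>x\<^sub>x)\<^sup>s u\<close> need not be a pointwise convergent Fourier series.\<close>

definition fNLS_solution ::
  "real \<Rightarrow> real \<Rightarrow> (real \<Rightarrow> complex) \<Rightarrow> (real \<Rightarrow> real \<Rightarrow> complex) \<Rightarrow> bool" where
  "fNLS_solution s T u0 u \<longleftrightarrow>
     u 0 = u0 \<and>
     (\<forall>t\<in>{0..T}. \<forall>k.
        ((\<lambda>\<tau>. fourier (u \<tau>) k) has_vector_derivative
           - \<i> * of_real (\<bar>real_of_int k\<bar> powr (2 * s)) * fourier (u t) k
           + \<i> * fourier (cubic (u t)) k) (at t within {0..T}))"

end

theory Submission
  imports Defs
begin

text \<open>The Fourier coefficients of the Galerkin solution satisfy
  \<open>a\<^sub>k' = - i |k|\<^sup>2\<^sup>s a\<^sub>k + i (a * conj a * a)\<^sub>k\<close> for \<open>|k| \<le> N\<close>, and this system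
  conserves \<open>\<Sum> |a\<^sub>k|\<^sup>2\<close> and the energy. By Cauchy-Schwarz with the weight \<open>1 + |k|\<^sup>2\<^sup>s\<close>,
  the smallness of the mass allows the quartic term to be absorbed in the kinetic one, which
  bounds \<open>\<Sum> |a\<^sub>k|\<close> uniformly in \<open>N\<close> and \<open>t\<close>. A tame estimate for the cubic convolution and
  Gronwall's inequality then bound every \<open>\<Sum> (1 + |k|)\<^sup>m |a\<^sub>k|\<close>, the initial values being
  bounded because \<open>u\<^sub>0\<close> is smooth. These weighted norms are submultiplicative, so the families
  with \<open>j\<close> time derivatives bounded in all of them are closed under the operations on the
  right-hand side of the system, and induction on \<open>j\<close> applies.\<close>

section \<open>Trigonometric polynomials and their coefficients\<close>

abbreviation freqs :: "nat \<Rightarrow> int set" where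
  "freqs N \<equiv> {- int N..int N}"

definition trig_sum :: "nat \<Rightarrow> (int \<Rightarrow> complex) \<Rightarrow> real \<Rightarrow> complex" where
  "trig_sum N c x = (\<Sum>k\<in>freqs N. c k * expo k x)"

text \<open>The \<open>k\<close>-th Fourier coefficient of the product of the first polynomial, the
  conjugate of the second, and the third. The constraint is kept as an equation between sums of two
  frequencies, so that the symmetries of \<open>quart\<close> become mere relabellings.\<close>

definition tri ::
  "nat \<Rightarrow> (int \<Rightarrow> complex) \<Rightarrow> (int \<Rightarrow> complex) \<Rightarrow> (int \<Rightarrow> complex) \<Rightarrow>
   int \<Rightarrow> complex" where
  "tri N f g h k = (\<Sum>p\<in>freqs N. \<Sum>q\<in>freqs N. \<Sum>r\<in>freqs N.
     of_bool (p + r = q + k) * (f p * cnj (g q) * h r))"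

section \<open>Exponentials, their orthogonality and Fourier coefficients of finite sums\<close>

lemma expo_0 [simp]: "expo 0 x = 1"
  by (simp add: expo_def)

lemma expo_add: "expo (m + n) x = expo m x * expo n x"
  by (simp add: expo_def exp_add[symmetric] algebra_simps)

lemma cnj_expo: "cnj (expo k x) = expo (- k) x"
  by (simp add: expo_def exp_cnj)

lemma norm_expo [simp]: "cmod (expo k x) = 1"
  by (simp add: expo_def norm_exp_eq_Re)

lemma expo_periodic: "expo k (x + 2 * pi) = expo k x"
proof -
  have "exp (2 * complex_of_real pi * \<i> * of_int k) = 1"
    by (simp add: exp_eq_1 mult.assoc)
  then show ?thesis
    by (simp add: expo_def algebra_simps exp_add)
qed

lemma expo_has_vector_derivative:
  "(expo k has_vector_derivative \<i> * of_int k * expo k x) (at x within S)"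
  unfolding expo_def
  by (rule has_vector_derivative_real_field, rule DERIV_subset)
     (auto intro!: derivative_eq_intros)

lemma continuous_on_expo [continuous_intros]: "continuous_on S (expo k)"
  unfolding expo_def by (intro continuous_intros)

lemma sum_product3:
  fixes F G H :: "'a \<Rightarrow> 'b::comm_semiring_1"
  shows "sum F A * sum G A * sum H A = (\<Sum>p\<in>A. \<Sum>q\<in>A. \<Sum>r\<in>A. F p * G q * H r)"
  by (simp only: mult.assoc sum_distrib_right) (simp only: sum_distrib_left)

lemma has_integral_expo:
  "(expo n has_integral (if n = 0 then 2 * pi else 0)) {-pi..pi}"
proof (cases "n = 0")
  case True
  have "expo 0 = (\<lambda>x. 1)" by auto
  with True show ?thesis
    using has_integral_const_real[of "1::complex" "-pi" pi] by (simp add: scaleR_conv_of_real)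
next
  case False
  let ?F = "\<lambda>x. expo n x / (\<i> * of_int n)"
  have "(expo n has_integral (?F pi - ?F (-pi))) {-pi..pi}"
    using False expo_has_vector_derivative[of n]
    by (intro fundamental_theorem_of_calculus)
       (auto intro!: has_vector_derivative_divide[THEN has_vector_derivative_eq_rhs])
  moreover have "expo n pi = expo n (-pi)"
    using expo_periodic[of n "-pi"] by simp
  ultimately show ?thesis using False by simp
qed

text \<open>The definitions use Lebesgue integrals, the computations gauge integrals; for continuous
  integrands the two agree.\<close>

lemma lebesgue_integral_eq_integral:
  fixes f :: "real \<Rightarrow> 'a::euclidean_space"
  assumes "continuous_on {a..b} f"
  shows "(LINT x:{a..b}|lebesgue. f x) = integral {a..b} f"
  using assms absolutely_integrable_continuous_real set_lebesgue_integral_eq_integral(2) by blast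

lemma fourier_eq_integral:
  assumes "continuous_on {-pi..pi} u"
  shows "fourier u k = of_real (1 / (2 * pi)) * integral {-pi..pi} (\<lambda>x. u x * expo (- k) x)"
  unfolding fourier_def
  by (subst lebesgue_integral_eq_integral) (intro continuous_intros assms, simp)

text \<open>The frequencies \<open>n i\<close> may repeat, so this also applies to an expanded
  product indexed by tuples of frequencies.\<close>

lemma fourier_sum_expo:
  assumes "finite A"
  shows "fourier (\<lambda>x. \<Sum>i\<in>A. c i * expo (n i) x) k = (\<Sum>i\<in>A. if n i = k then c i else 0)"
proof -
  have "((\<lambda>x. \<Sum>i\<in>A. c i * expo (n i + (- k)) x) has_integral
      (\<Sum>i\<in>A. c i * (if n i + (- k) = 0 then 2 * pi else 0))) {-pi..pi}"
    by (intro has_integral_sum has_integral_mult_right has_integral_expo assms)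
  then have "integral {-pi..pi} (\<lambda>x. (\<Sum>i\<in>A. c i * expo (n i) x) * expo (- k) x)
      = (\<Sum>i\<in>A. c i * (if n i + (- k) = 0 then 2 * pi else 0))"
    by (simp only: expo_add sum_distrib_right mult.assoc integral_unique)
  then show ?thesis
    by (subst fourier_eq_integral)
       (auto intro!: continuous_intros sum.cong simp: sum_distrib_left)
qed

section \<open>The operators and functionals of the problem on trigonometric polynomials\<close>

lemma fourier_trig_sum: "fourier (trig_sum N c) k = (if k \<in> freqs N then c k else 0)"
  unfolding trig_sum_def
  by (subst fourier_sum_expo) auto

lemma trig_sum_cong: "(\<And>k. k \<in> freqs N \<Longrightarrow> c k = d k) \<Longrightarrow> trig_sum N c = trig_sum N d"
  unfolding trig_sum_def by (intro ext sum.cong) auto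

lemma trig_space_eq:
  assumes "v \<in> trig_space N"
  shows "v = trig_sum N (fourier v)"
proof -
  obtain c where "v = trig_sum N c"
    using assms by (auto simp: trig_space_def trig_sum_def fun_eq_iff)
  then show ?thesis
    using trig_sum_cong[of N c "fourier v"] by (simp add: fourier_trig_sum)
qed

lemma continuous_on_trig_sum [continuous_intros]: "continuous_on S (trig_sum N c)"
  unfolding trig_sum_def by (intro continuous_intros)

lemma periodic_trig_sum: "periodic (trig_sum N c)"
  unfolding periodic_def trig_sum_def by (simp add: expo_periodic)

lemma frac_lap_trig_sum:
  "frac_lap s (trig_sum N c) = trig_sum N (\<lambda>k. of_real (\<bar>real_of_int k\<bar> powr (2 * s)) * c k)"
proof
  fix x
  have "frac_lap s (trig_sum N c) x = (\<Sum>\<^sub>\<infinity>k\<in>freqs N.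
      of_real (\<bar>real_of_int k\<bar> powr (2 * s)) * fourier (trig_sum N c) k * expo k x)"
    unfolding frac_lap_def by (rule infsum_cong_neutral) (auto simp: fourier_trig_sum)
  then show "frac_lap s (trig_sum N c) x = trig_sum N (\<lambda>k. of_real (\<bar>real_of_int k\<bar> powr (2 * s)) * c k) x"
    by (simp add: trig_sum_def fourier_trig_sum)
qed

text \<open>Expanding \<open>u * cnj u * u\<close> gives one exponential of frequency
  \<open>p + r - q\<close> for each triple.\<close>

lemma fourier_cubic_trig_sum: "fourier (cubic (trig_sum N c)) k = tri N c c c k"
proof -
  let ?I = "freqs N"
  have "cubic (trig_sum N c) = (\<lambda>x. \<Sum>(p, q, r)\<in>?I \<times> ?I \<times> ?I. c p * cnj (c q) * c r * expo (p + r - q) x)"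
  proof
    fix x
    have "cubic (trig_sum N c) x = trig_sum N c x * cnj (trig_sum N c x) * trig_sum N c x"
      by (simp only: cubic_def complex_norm_square)
    also have "\<dots> = (\<Sum>p\<in>?I. \<Sum>q\<in>?I. \<Sum>r\<in>?I. c p * cnj (c q) * c r * expo (p + r - q) x)"
      unfolding trig_sum_def cnj_sum sum_product3
      by (simp only: complex_cnj_mult cnj_expo diff_conv_add_uminus expo_add mult_ac)
    finally show "cubic (trig_sum N c) x = (\<Sum>(p, q, r)\<in>?I \<times> ?I \<times> ?I. c p * cnj (c q) * c r * expo (p + r - q) x)"
      by (simp add: sum.cartesian_product)
  qed
  then have "fourier (cubic (trig_sum N c)) k =
      fourier (\<lambda>x. \<Sum>i\<in>?I \<times> ?I \<times> ?I. (case i of (p, q, r) \<Rightarrow> c p * cnj (c q) * c r) *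
         expo (case i of (p, q, r) \<Rightarrow> p + r - q) x) k"
    by (simp add: case_prod_unfold)
  also have "\<dots> = tri N c c c k"
    by (subst fourier_sum_expo)
       (auto simp: tri_def sum.cartesian_product case_prod_unfold algebra_simps intro!: sum.cong)
  finally show ?thesis .
qed

text \<open>Parseval's identity; \<open>pi\<close> is the period \<open>2 * pi\<close> times the
  factor \<open>1/2\<close> in \<open>mass\<close>.\<close>

lemma mass_trig_sum: "mass (trig_sum N c) = pi * (\<Sum>k\<in>freqs N. (cmod (c k))\<^sup>2)"
proof -
  let ?I = "freqs N"
  let ?S = "\<Sum>p\<in>?I. \<Sum>q\<in>?I. c p * cnj (c q) * (if p + - q = 0 then 2 * pi else 0)"
  have "((\<lambda>x. \<Sum>p\<in>?I. \<Sum>q\<in>?I. c p * cnj (c q) * expo (p + - q) x) has_integral ?S) {-pi..pi}"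
    by (intro has_integral_sum has_integral_mult_right has_integral_expo) auto
  then have "((\<lambda>x. Re (\<Sum>p\<in>?I. \<Sum>q\<in>?I. c p * cnj (c q) * expo (p + - q) x)) has_integral Re ?S) {-pi..pi}"
    using has_integral_linear[OF _ bounded_linear_Re] unfolding o_def by blast
  moreover have "Re (\<Sum>p\<in>?I. \<Sum>q\<in>?I. c p * cnj (c q) * expo (p + - q) x) = (cmod (trig_sum N c x))\<^sup>2" for x
  proof -
    have "(\<Sum>p\<in>?I. \<Sum>q\<in>?I. c p * cnj (c q) * expo (p + - q) x) = trig_sum N c x * cnj (trig_sum N c x)"
      unfolding trig_sum_def cnj_sum sum_product
      by (simp only: complex_cnj_mult cnj_expo expo_add mult_ac)
    also have "\<dots> = of_real ((cmod (trig_sum N c x))\<^sup>2)"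
      by (rule complex_norm_square[symmetric])
    finally show ?thesis by simp
  qed
  moreover have "?S = of_real (2 * pi * (\<Sum>k\<in>?I. (cmod (c k))\<^sup>2))"
    by (simp add: if_distrib complex_norm_square[symmetric] sum_distrib_left mult_ac cong: if_cong
        flip: of_real_power)
  ultimately have "((\<lambda>x. (cmod (trig_sum N c x))\<^sup>2) has_integral (2 * pi * (\<Sum>k\<in>?I. (cmod (c k))\<^sup>2))) {-pi..pi}"
    by (simp only: Re_complex_of_real)
  then show ?thesis
    unfolding mass_def
    by (subst lebesgue_integral_eq_integral) (auto intro!: continuous_intros simp: integral_unique)
qed

text \<open>Recovering coefficients from finitely many samples turns the pointwise time
  derivatives of a curve of trigonometric polynomials into derivatives of the coefficients.\<close>

lemma trig_sum_sampling:
  fixes N :: nat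
  defines "M \<equiv> 2 * N + 1"
  defines "\<xi> \<equiv> \<lambda>j::nat. 2 * pi * real j / real M"
  assumes "k \<in> freqs N"
  shows "c k = (\<Sum>j<M. trig_sum N c (\<xi> j) * expo (- k) (\<xi> j)) / of_nat M"
proof -
  have M: "M > 0" by (simp add: M_def)
  \<comment> \<open>A geometric sum of an \<open>M\<close>-th root of unity. Two frequencies in
    \<open>freqs N\<close> differ by at most \<open>2 * N < M\<close>, so distinct ones are not
    aliased on the grid.\<close>
  have orth: "(\<Sum>j<M. expo n (\<xi> j)) = (if n = 0 then of_nat M else 0)"
    if n: "\<bar>n\<bar> < int M" for n
  proof (cases "n = 0")
    case False
    define z where "z = expo n (2 * pi / real M)"
    have pow: "expo n (\<xi> j) = z ^ j" for j
      by (simp add: z_def \<xi>_def expo_def exp_of_nat_mult[symmetric] field_simps)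
    have "z ^ M = expo n (\<xi> M)" by (simp add: pow)
    also have "\<dots> = 1"
      using M expo_periodic[of n 0] by (simp add: \<xi>_def) (simp add: expo_def)
    finally have zM: "z ^ M = 1" .
    have "z \<noteq> 1"
    proof
      \<comment> \<open>Then \<open>M\<close> divides \<open>n\<close>, which is impossible for
        \<open>0 < |n| < M\<close>.\<close>
      assume "z = 1"
      then obtain i :: int where "2 * pi / M * n = of_int (2 * i) * pi"
        unfolding z_def expo_def exp_eq_1 by (auto simp: algebra_simps)
      then have "real_of_int n = of_int (i * int M)"
        using M by (simp add: field_simps)
      then have "n = i * int M" by (simp only: of_int_eq_iff)
      with n False show False
        by (auto simp: abs_mult)
    qed
    then show ?thesis
      using False by (simp add: pow sum_gp_strict zM)
  qed simp
  have "(\<Sum>j<M. trig_sum N c (\<xi> j) * expo (- k) (\<xi> j))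
      = (\<Sum>p\<in>freqs N. c p * (\<Sum>j<M. expo (p + - k) (\<xi> j)))"
    unfolding trig_sum_def sum_distrib_right sum_distrib_left
    by (subst sum.swap) (simp only: expo_add mult.assoc)
  also have "\<dots> = (\<Sum>p\<in>freqs N. c p * (if p + - k = 0 then of_nat M else 0))"
    using assms(3) by (intro sum.cong refl arg_cong2[where f="(*)"] orth) (auto simp: M_def)
  also have "\<dots> = c k * of_nat M"
    using assms(3) by (simp add: if_distrib cong: if_cong)
  finally show ?thesis using M by simp
qed

section \<open>The Galerkin equation as a system for the coefficients\<close>

definition coeff_rhs :: "real \<Rightarrow> nat \<Rightarrow> (int \<Rightarrow> complex) \<Rightarrow> int \<Rightarrow> complex" where
  "coeff_rhs s N a k = - \<i> * of_real (\<bar>real_of_int k\<bar> powr (2 * s)) * a k + \<i> * tri N a a a k"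

lemma galerkin_rhs_trig_sum: "galerkin_rhs s N (trig_sum N a) = trig_sum N (coeff_rhs s N a)"
proof
  fix x
  show "galerkin_rhs s N (trig_sum N a) x = trig_sum N (coeff_rhs s N a) x"
    unfolding galerkin_rhs_def frac_lap_trig_sum trig_proj_def fourier_cubic_trig_sum
    by (simp add: trig_sum_def coeff_rhs_def sum_distrib_left sum.distrib[symmetric] algebra_simps sum_subtractf)
qed

lemma galerkin_solution_coeffs:
  assumes "galerkin_solution s T N u0 v" "t \<in> {0..T}" "k \<in> freqs N"
  shows "((\<lambda>\<tau>. fourier (v \<tau>) k) has_vector_derivative coeff_rhs s N (fourier (v t)) k) (at t within {0..T})"
proof -
  define M where "M = 2 * N + 1"
  define \<xi> where "\<xi> = (\<lambda>j::nat. 2 * pi * real j / real M)"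
  have eq: "v \<tau> = trig_sum N (fourier (v \<tau>))" if "\<tau> \<in> {0..T}" for \<tau>
    using that assms(1) by (intro trig_space_eq) (auto simp: galerkin_solution_def)
  have "((\<lambda>\<tau>. v \<tau> x) has_vector_derivative trig_sum N (coeff_rhs s N (fourier (v t))) x) (at t within {0..T})" for x
    using assms(1,2) galerkin_rhs_trig_sum eq[OF assms(2)] by (metis galerkin_solution_def)
  then have "((\<lambda>\<tau>. (\<Sum>j<M. v \<tau> (\<xi> j) * expo (- k) (\<xi> j)) / of_nat M) has_vector_derivative
      (\<Sum>j<M. trig_sum N (coeff_rhs s N (fourier (v t))) (\<xi> j) * expo (- k) (\<xi> j)) / of_nat M) (at t within {0..T})"
    by (intro has_vector_derivative_divide has_vector_derivative_sum has_vector_derivative_mult_left) auto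
  then have "((\<lambda>\<tau>. (\<Sum>j<M. v \<tau> (\<xi> j) * expo (- k) (\<xi> j)) / of_nat M) has_vector_derivative
      coeff_rhs s N (fourier (v t)) k) (at t within {0..T})"
    unfolding M_def \<xi>_def using trig_sum_sampling[OF assms(3), of "coeff_rhs s N (fourier (v t))"] by simp
  then show ?thesis
  proof (rule has_vector_derivative_transform[OF assms(2), rotated])
    fix \<tau> assume "\<tau> \<in> {0..T}"
    then show "fourier (v \<tau>) k = (\<Sum>j<M. v \<tau> (\<xi> j) * expo (- k) (\<xi> j)) / of_nat M"
      using trig_sum_sampling[OF assms(3), of "fourier (v \<tau>)"] eq[of \<tau>] by (simp add: M_def \<xi>_def)
  qed
qed

section \<open>Cubic convolutions in weighted summation norms\<close>

text \<open>A weighted Wiener algebra norm, truncated to \<open>freqs N\<close>. With absolute sums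
  in place of square sums, a convolution estimate reduces to a pointwise inequality between
  weights.\<close>

definition wnorm :: "nat \<Rightarrow> nat \<Rightarrow> (int \<Rightarrow> complex) \<Rightarrow> real" where
  "wnorm m N c = (\<Sum>k\<in>freqs N. (1 + \<bar>real_of_int k\<bar>) ^ m * cmod (c k))"

lemma wnorm_nonneg: "wnorm m N c \<ge> 0"
  unfolding wnorm_def by (intro sum_nonneg) auto

lemma wnorm_cong: "(\<And>k. k \<in> freqs N \<Longrightarrow> cmod (c k) = cmod (d k)) \<Longrightarrow> wnorm m N c = wnorm m N d"
  unfolding wnorm_def by (intro sum.cong) auto

lemma wnorm_add: "wnorm m N (\<lambda>k. c k + d k) \<le> wnorm m N c + wnorm m N d"
  unfolding wnorm_def sum.distrib[symmetric] distrib_left[symmetric]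
  by (intro sum_mono mult_left_mono norm_triangle_ineq) auto

text \<open>A multiplier of order \<open>n\<close> costs \<open>n\<close> powers of the weight,
  which is why bounds are later required for all \<open>m\<close> at once.\<close>

lemma wnorm_multiplier:
  assumes "\<And>k. cmod (g k) \<le> (1 + \<bar>real_of_int k\<bar>) ^ n"
  shows "wnorm m N (\<lambda>k. g k * c k) \<le> wnorm (m + n) N c"
  unfolding wnorm_def norm_mult power_add mult.assoc
  by (intro sum_mono mult_left_mono mult_right_mono assms) auto

lemma norm_tri_le:
  "cmod (tri N f g h k) \<le> (\<Sum>p\<in>freqs N. \<Sum>q\<in>freqs N. \<Sum>r\<in>freqs N.
     of_bool (p + r = q + k) * (cmod (f p) * cmod (g q) * cmod (h r)))"
  unfolding tri_def
  by (intro sum_norm_le) (simp add: norm_mult of_bool_def)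

text \<open>Common core of the two cubic estimates below. Given \<open>p\<close>, \<open>q\<close>,
  \<open>r\<close>, the constraint leaves at most one \<open>k\<close>; nonnegativity of
  \<open>V\<close> covers the case that \<open>p + r - q\<close> falls outside
  \<open>freqs N\<close>.\<close>

lemma weighted_norm_tri_le:
  fixes W :: "int \<Rightarrow> real"
  assumes W: "\<And>k. W k \<ge> 0" and V: "\<And>p q r. V p q r \<ge> 0"
    and WV: "\<And>p q r k. p + r = q + k \<Longrightarrow> W k \<le> V p q r"
  shows "(\<Sum>k\<in>freqs N. W k * cmod (tri N f g h k)) \<le>
    (\<Sum>p\<in>freqs N. \<Sum>q\<in>freqs N. \<Sum>r\<in>freqs N. V p q r * (cmod (f p) * cmod (g q) * cmod (h r)))"
proof -
  let ?I = "freqs N"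
  have "(\<Sum>k\<in>?I. W k * cmod (tri N f g h k)) \<le> (\<Sum>k\<in>?I. W k * (\<Sum>p\<in>?I. \<Sum>q\<in>?I. \<Sum>r\<in>?I.
      of_bool (p + r = q + k) * (cmod (f p) * cmod (g q) * cmod (h r))))"
    by (intro sum_mono mult_left_mono norm_tri_le W)
  also have "\<dots> = (\<Sum>p\<in>?I. \<Sum>q\<in>?I. \<Sum>r\<in>?I. (\<Sum>k\<in>?I. W k * of_bool (p + r = q + k)) *
      (cmod (f p) * cmod (g q) * cmod (h r)))"
    unfolding sum_distrib_left sum_distrib_right
    by (subst sum.swap, rule sum.cong[OF refl], subst sum.swap, rule sum.cong[OF refl], subst sum.swap)
       (simp only: mult.assoc)
  also have "\<dots> \<le> (\<Sum>p\<in>?I. \<Sum>q\<in>?I. \<Sum>r\<in>?I. V p q r * (cmod (f p) * cmod (g q) * cmod (h r)))"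
  proof (intro sum_mono mult_right_mono)
    fix p q r
    have "(\<Sum>k\<in>?I. W k * of_bool (p + r = q + k)) = (\<Sum>k\<in>?I. if k = p + r - q then W k else 0)"
      by (intro sum.cong) auto
    also have "\<dots> \<le> V p q r"
      using V WV[of p r q "p + r - q"] by (simp add: sum.delta)
    finally show "(\<Sum>k\<in>?I. W k * of_bool (p + r = q + k)) \<le> V p q r" .
  qed auto
  finally show ?thesis .
qed

text \<open>Since \<open>k = p + r - q\<close>, the number \<open>1 + |k|\<close> is at most the
  product of \<open>1 + |p|\<close>, \<open>1 + |q|\<close> and \<open>1 + |r|\<close>, so the
  weight distributes over the factors.\<close>

lemma wnorm_tri: "wnorm m N (tri N f g h) \<le> wnorm m N f * wnorm m N g * wnorm m N h"
proof -
  let ?w = "\<lambda>k. (1 + \<bar>real_of_int k\<bar>) ^ m"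
  have "?w k \<le> ?w p * ?w q * ?w r" if "p + r = q + k" for p q r k
  proof -
    have "1 + \<bar>real_of_int k\<bar> \<le> 1 + (\<bar>real_of_int p\<bar> + \<bar>real_of_int q\<bar> + \<bar>real_of_int r\<bar>)"
      using that by linarith
    also have "\<dots> \<le> (1 + \<bar>real_of_int p\<bar>) * (1 + \<bar>real_of_int q\<bar>) * (1 + \<bar>real_of_int r\<bar>)"
      by (simp add: algebra_simps)
    finally show ?thesis
      unfolding power_mult_distrib[symmetric] by (intro power_mono) auto
  qed
  then have "wnorm m N (tri N f g h) \<le> (\<Sum>p\<in>freqs N. \<Sum>q\<in>freqs N. \<Sum>r\<in>freqs N.
      ?w p * ?w q * ?w r * (cmod (f p) * cmod (g q) * cmod (h r)))"
    unfolding wnorm_def by (intro weighted_norm_tri_le) auto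
  also have "\<dots> = wnorm m N f * wnorm m N g * wnorm m N h"
    unfolding wnorm_def sum_product3 by (simp only: mult_ac)
  finally show ?thesis .
qed

text \<open>The weight of \<open>k\<close> is controlled by that of the largest of the three
  frequencies, so only one factor has to carry it. The bound is thus linear in
  \<open>wnorm m N a\<close>, as Gronwall's inequality requires. The \<open>3 ^ m\<close> comes from
  \<open>1 + |k| <= 3 * M\<close>, the other \<open>3\<close> from the three possible
  positions.\<close>

lemma wnorm_tri_tame:
  "wnorm m N (tri N a a a) \<le> 3 * 3 ^ m * (wnorm 0 N a)\<^sup>2 * wnorm m N a"
proof -
  let ?w = "\<lambda>k. (1 + \<bar>real_of_int k\<bar>) ^ m"
  have "?w k \<le> 3 ^ m * (?w p + ?w q + ?w r)" if "p + r = q + k" for p q r k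
  proof -
    define M where "M = Max {1 + \<bar>real_of_int p\<bar>, 1 + \<bar>real_of_int q\<bar>, 1 + \<bar>real_of_int r\<bar>}"
    have le: "1 + \<bar>real_of_int p\<bar> \<le> M" "1 + \<bar>real_of_int q\<bar> \<le> M" "1 + \<bar>real_of_int r\<bar> \<le> M"
      unfolding M_def by (auto intro: Max_ge)
    have "M \<in> {1 + \<bar>real_of_int p\<bar>, 1 + \<bar>real_of_int q\<bar>, 1 + \<bar>real_of_int r\<bar>}"
      unfolding M_def by (intro Max_in) auto
    then have M: "M ^ m \<le> ?w p + ?w q + ?w r" by auto
    have "1 + \<bar>real_of_int k\<bar> \<le> 3 * M" using that le by linarith
    then have "?w k \<le> (3 * M) ^ m" by (intro power_mono) auto
    also have "\<dots> \<le> 3 ^ m * (?w p + ?w q + ?w r)"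
      unfolding power_mult_distrib using M by simp
    finally show ?thesis .
  qed
  then have "wnorm m N (tri N a a a) \<le> (\<Sum>p\<in>freqs N. \<Sum>q\<in>freqs N. \<Sum>r\<in>freqs N.
      3 ^ m * (?w p + ?w q + ?w r) * (cmod (a p) * cmod (a q) * cmod (a r)))"
    unfolding wnorm_def by (intro weighted_norm_tri_le) auto
  also have "\<dots> = 3 ^ m * (wnorm m N a * wnorm 0 N a * wnorm 0 N a + wnorm 0 N a * wnorm m N a * wnorm 0 N a
      + wnorm 0 N a * wnorm 0 N a * wnorm m N a)"
    unfolding wnorm_def sum_product3 sum.distrib[symmetric]
    unfolding sum_distrib_left
    by (intro sum.cong refl) (simp add: algebra_simps)
  also have "\<dots> = 3 * 3 ^ m * (wnorm 0 N a)\<^sup>2 * wnorm m N a"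
    by (simp add: power2_eq_square algebra_simps)
  finally show ?thesis .
qed

text \<open>On the Fourier side, \<open>quart N f g h e\<close> is the mean over a period of the product of
  \<open>f\<close>, \<open>h\<close> and the conjugates of \<open>g\<close>, \<open>e\<close>; \<open>quart N a a a a\<close> is the mean of \<open>|u|\<^sup>4\<close>.\<close>

definition quart ::
  "nat \<Rightarrow> (int \<Rightarrow> complex) \<Rightarrow> (int \<Rightarrow> complex) \<Rightarrow> (int \<Rightarrow> complex) \<Rightarrow>
   (int \<Rightarrow> complex) \<Rightarrow> complex" where
  "quart N f g h e = (\<Sum>k\<in>freqs N. cnj (e k) * tri N f g h k)"

text \<open>With a single sum over tuples, each of the three symmetries below is a permutation of
  the indices that preserves \<open>p + r = q + k\<close>.\<close>

lemma quart_eq: "quart N f g h e = (\<Sum>(k, p, q, r)\<in>freqs N \<times> freqs N \<times> freqs N \<times> freqs N.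
     of_bool (p + r = q + k) * (f p * cnj (g q) * h r * cnj (e k)))"
  unfolding quart_def tri_def sum_distrib_left sum.cartesian_product
  by (intro sum.cong) (auto simp: mult_ac)

lemma quart_swap_fh: "quart N f g h e = quart N h g f e"
  unfolding quart_eq
  by (rule sum.reindex_bij_witness[of _ "\<lambda>(k, p, q, r). (k, r, q, p)" "\<lambda>(k, p, q, r). (k, r, q, p)"])
     (auto simp: of_bool_def)

lemma quart_swap_ge: "quart N f g h e = quart N f e h g"
  unfolding quart_eq
  by (rule sum.reindex_bij_witness[of _ "\<lambda>(k, p, q, r). (q, p, k, r)" "\<lambda>(k, p, q, r). (q, p, k, r)"])
     (auto simp: of_bool_def)

lemma quart_cnj: "cnj (quart N f g h e) = quart N g f e h"
  unfolding quart_eq cnj_sum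
  by (rule sum.reindex_bij_witness[of _ "\<lambda>(k, p, q, r). (r, q, p, k)" "\<lambda>(k, p, q, r). (r, q, p, k)"])
     (auto simp: of_bool_def)

text \<open>Fourier counterpart of bounding the mean of \<open>|u|^4\<close> by
  \<open>sup |u|^2\<close> times the mean of \<open>|u|^2\<close>, with \<open>wnorm 0\<close> in
  place of the supremum.\<close>

lemma norm_quart_le:
  "cmod (quart N a a a a) \<le> (wnorm 0 N a)\<^sup>2 * (\<Sum>k\<in>freqs N. (cmod (a k))\<^sup>2)"
proof -
  let ?I = "freqs N"
  let ?M = "\<Sum>k\<in>?I. (cmod (a k))\<^sup>2"
  \<comment> \<open>For fixed \<open>p\<close> and \<open>q\<close> the constraint makes
    \<open>k\<close> and \<open>r\<close> determine each other, so after
    \<open>x * y <= x^2 / 2 + y^2 / 2\<close> each half is at most \<open>?M / 2\<close>.\<close>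
  have one: "(\<Sum>k\<in>?I. \<Sum>r\<in>?I. of_bool (p + r = q + k) * (cmod (a r) * cmod (a k))) \<le> ?M" for p q
  proof -
    have "(\<Sum>k\<in>?I. \<Sum>r\<in>?I. of_bool (p + r = q + k) * (cmod (a r) * cmod (a k)))
      \<le> (\<Sum>k\<in>?I. \<Sum>r\<in>?I. of_bool (p + r = q + k) * ((cmod (a r))\<^sup>2 / 2 + (cmod (a k))\<^sup>2 / 2))"
    proof (intro sum_mono mult_left_mono)
      fix k r show "cmod (a r) * cmod (a k) \<le> (cmod (a r))\<^sup>2 / 2 + (cmod (a k))\<^sup>2 / 2"
        using sum_squares_bound[of "cmod (a r)" "cmod (a k)"] by simp
    qed auto
    also have "\<dots> = (\<Sum>k\<in>?I. \<Sum>r\<in>?I. if k = p + r - q then (cmod (a r))\<^sup>2 / 2 else 0)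
        + (\<Sum>k\<in>?I. \<Sum>r\<in>?I. if r = q + k - p then (cmod (a k))\<^sup>2 / 2 else 0)"
      unfolding sum.distrib[symmetric] by (intro sum.cong refl) auto
    also have "\<dots> = (\<Sum>r\<in>?I. \<Sum>k\<in>?I. if k = p + r - q then (cmod (a r))\<^sup>2 / 2 else 0)
        + (\<Sum>k\<in>?I. \<Sum>r\<in>?I. if r = q + k - p then (cmod (a k))\<^sup>2 / 2 else 0)"
      by (subst sum.swap) (rule refl)
    also have "\<dots> \<le> ?M / 2 + ?M / 2"
      unfolding sum_divide_distrib by (intro add_mono sum_mono) (auto simp: sum.delta)
    finally show ?thesis by simp
  qed
  have "cmod (quart N a a a a) \<le> (\<Sum>k\<in>?I. \<Sum>p\<in>?I. \<Sum>q\<in>?I. \<Sum>r\<in>?I.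
      of_bool (p + r = q + k) * (cmod (a p) * cmod (a q) * cmod (a r) * cmod (a k)))"
    unfolding quart_def tri_def sum_distrib_left by (intro sum_norm_le) (simp add: norm_mult of_bool_def)
  also have "\<dots> = (\<Sum>p\<in>?I. \<Sum>q\<in>?I. cmod (a p) * cmod (a q) *
      (\<Sum>k\<in>?I. \<Sum>r\<in>?I. of_bool (p + r = q + k) * (cmod (a r) * cmod (a k))))"
    unfolding sum_distrib_left
    by (subst sum.swap, rule sum.cong[OF refl], subst sum.swap) (simp only: mult_ac)
  also have "\<dots> \<le> (\<Sum>p\<in>?I. \<Sum>q\<in>?I. cmod (a p) * cmod (a q) * ?M)"
    by (intro sum_mono mult_left_mono one) auto
  also have "\<dots> = (wnorm 0 N a)\<^sup>2 * ?M"
    unfolding wnorm_def power2_eq_square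
    by (simp add: sum_distrib_right[symmetric] sum_distrib_left[symmetric])
  finally show ?thesis .
qed

section \<open>Tools for differentiation in time\<close>

lemma tri_has_vector_derivative:
  assumes "\<And>k. k \<in> freqs N \<Longrightarrow> ((\<lambda>\<tau>. f \<tau> k) has_vector_derivative f' k) (at t within S)"
    and "\<And>k. k \<in> freqs N \<Longrightarrow> ((\<lambda>\<tau>. g \<tau> k) has_vector_derivative g' k) (at t within S)"
    and "\<And>k. k \<in> freqs N \<Longrightarrow> ((\<lambda>\<tau>. h \<tau> k) has_vector_derivative h' k) (at t within S)"
  shows "((\<lambda>\<tau>. tri N (f \<tau>) (g \<tau>) (h \<tau>) k) has_vector_derivative
    (tri N f' (g t) (h t) k + tri N (f t) g' (h t) k + tri N (f t) (g t) h' k)) (at t within S)"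
  unfolding tri_def sum.distrib[symmetric]
proof (intro has_vector_derivative_sum)
  fix p q r assume I: "p \<in> freqs N" "q \<in> freqs N" "r \<in> freqs N"
  have "((\<lambda>\<tau>. cnj (g \<tau> q)) has_vector_derivative cnj (g' q)) (at t within S)"
    using bounded_linear.has_vector_derivative[OF bounded_linear_cnj assms(2)] I by blast
  from has_vector_derivative_mult[OF has_vector_derivative_mult[OF assms(1)[OF I(1)] this] assms(3)[OF I(3)]]
  show "((\<lambda>\<tau>. of_bool (p + r = q + k) * (f \<tau> p * cnj (g \<tau> q) * h \<tau> r)) has_vector_derivative
      of_bool (p + r = q + k) * (f' p * cnj (g t q) * h t r) +
      of_bool (p + r = q + k) * (f t p * cnj (g' q) * h t r) +
      of_bool (p + r = q + k) * (f t p * cnj (g t q) * h' r)) (at t within S)"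
    by (auto dest!: has_vector_derivative_mult_right[where a = "of_bool (p + r = q + k)"]
        elim!: has_vector_derivative_eq_rhs simp: algebra_simps)
qed

lemma eq_initial_if_has_vector_derivative_zero:
  fixes f :: "real \<Rightarrow> complex"
  assumes "\<And>t. t \<in> {0..T} \<Longrightarrow> (f has_vector_derivative 0) (at t within {0..T})" "t \<in> {0..T}"
  shows "f t = f 0"
proof -
  obtain c where "\<And>x. x \<in> {0..T} \<Longrightarrow> f x = c"
    using has_vector_derivative_zero_constant[OF convex_real_interval(5) assms(1)] by metis
  then show ?thesis using assms(2) by force
qed

section \<open>Conservation laws and uniform bounds\<close>

definition coeff_flow ::
  "real \<Rightarrow> real \<Rightarrow> nat \<Rightarrow> (real \<Rightarrow> int \<Rightarrow> complex) \<Rightarrow> bool" where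
  "coeff_flow s T N a \<longleftrightarrow> (\<forall>t\<in>{0..T}. \<forall>k\<in>freqs N.
     ((\<lambda>\<tau>. a \<tau> k) has_vector_derivative coeff_rhs s N (a t) k) (at t within {0..T}))"

definition l2sq :: "nat \<Rightarrow> (int \<Rightarrow> complex) \<Rightarrow> real" where
  "l2sq N a = (\<Sum>k\<in>freqs N. (cmod (a k))\<^sup>2)"

text \<open>By Parseval, the integral of the squared modulus of \<open>abs_D s u\<close>, divided by
  \<open>2 * pi\<close>.\<close>

definition kinetic :: "real \<Rightarrow> nat \<Rightarrow> (int \<Rightarrow> complex) \<Rightarrow> real" where
  "kinetic s N a = (\<Sum>k\<in>freqs N. \<bar>real_of_int k\<bar> powr (2 * s) * (cmod (a k))\<^sup>2)"

text \<open>The square is kept complex valued so that the product rule applies to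
  \<open>f * cnj f\<close>.\<close>

lemma cmod_sq_has_vector_derivative:
  assumes "(f has_vector_derivative f') (at t within S)"
  shows "((\<lambda>\<tau>. complex_of_real ((cmod (f \<tau>))\<^sup>2)) has_vector_derivative f' * cnj (f t) + f t * cnj f') (at t within S)"
proof -
  have "((\<lambda>\<tau>. cnj (f \<tau>)) has_vector_derivative cnj f') (at t within S)"
    using bounded_linear.has_vector_derivative[OF bounded_linear_cnj assms] .
  from has_vector_derivative_mult[OF assms this] show ?thesis
    by (simp only: complex_norm_square add.commute)
qed

lemma quart_real: "cnj (quart N a a a a) = quart N a a a a"
  by (rule quart_cnj)

text \<open>The multiplier is real, so the linear term contributes nothing to the derivative; the
  cubic term contributes twice the real part of \<open>\<i> * quart\<close>, which vanishes because
  \<open>quart\<close> is real here.\<close>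

lemma l2sq_conserved:
  assumes "coeff_flow s T N a" "t \<in> {0..T}"
  shows "l2sq N (a t) = l2sq N (a 0)"
proof -
  have "((\<lambda>\<tau>. complex_of_real (l2sq N (a \<tau>))) has_vector_derivative 0) (at t within {0..T})"
    if t: "t \<in> {0..T}" for t
  proof -
    let ?z = "coeff_rhs s N (a t)"
    have "((\<lambda>\<tau>. complex_of_real (l2sq N (a \<tau>))) has_vector_derivative
        (\<Sum>k\<in>freqs N. ?z k * cnj (a t k) + a t k * cnj (?z k))) (at t within {0..T})"
      unfolding l2sq_def of_real_sum
      using assms(1) t by (intro has_vector_derivative_sum cmod_sq_has_vector_derivative) (auto simp: coeff_flow_def)
    moreover have "(\<Sum>k\<in>freqs N. ?z k * cnj (a t k) + a t k * cnj (?z k))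
        = \<i> * quart N (a t) (a t) (a t) (a t) + cnj (\<i> * quart N (a t) (a t) (a t) (a t))"
      unfolding quart_def sum_distrib_left cnj_sum sum.distrib[symmetric]
      by (intro sum.cong refl) (simp add: coeff_rhs_def algebra_simps)
    ultimately show ?thesis by (simp add: quart_real)
  qed
  from eq_initial_if_has_vector_derivative_zero[OF this assms(2)] show ?thesis
    by (simp only: of_real_eq_iff)
qed

text \<open>The product rule puts \<open>a'\<close> into each of the four slots; by the symmetries
  two of the terms equal \<open>quart N (a t) (a t) (a t) a'\<close> and the other two its
  conjugate.\<close>

lemma quart_has_vector_derivative:
  assumes "\<And>k. k \<in> freqs N \<Longrightarrow> ((\<lambda>\<tau>. a \<tau> k) has_vector_derivative a' k) (at t within S)"
  shows "((\<lambda>\<tau>. quart N (a \<tau>) (a \<tau>) (a \<tau>) (a \<tau>)) has_vector_derivative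
     2 * (quart N (a t) (a t) (a t) a' + cnj (quart N (a t) (a t) (a t) a'))) (at t within S)"
proof -
  let ?b = "a t"
  have "((\<lambda>\<tau>. cnj (a \<tau> k) * tri N (a \<tau>) (a \<tau>) (a \<tau>) k) has_vector_derivative
     cnj (?b k) * (tri N a' ?b ?b k + tri N ?b a' ?b k + tri N ?b ?b a' k) + cnj (a' k) * tri N ?b ?b ?b k)
     (at t within S)" if "k \<in> freqs N" for k
    using bounded_linear.has_vector_derivative[OF bounded_linear_cnj assms[OF that]]
      tri_has_vector_derivative[OF assms assms assms]
    by (rule has_vector_derivative_mult)
  then have "((\<lambda>\<tau>. quart N (a \<tau>) (a \<tau>) (a \<tau>) (a \<tau>)) has_vector_derivative
     quart N a' ?b ?b ?b + quart N ?b a' ?b ?b + quart N ?b ?b a' ?b + quart N ?b ?b ?b a') (at t within S)"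
    unfolding quart_def sum.distrib[symmetric] distrib_left[symmetric]
    by (intro has_vector_derivative_sum) (simp add: algebra_simps)
  moreover have "quart N ?b a' ?b ?b = quart N ?b ?b ?b a'"
    by (rule quart_swap_ge)
  moreover have "quart N a' ?b ?b ?b = cnj (quart N ?b a' ?b ?b)"
    by (rule quart_cnj[symmetric])
  moreover have "quart N ?b ?b a' ?b = quart N a' ?b ?b ?b"
    by (rule quart_swap_fh)
  ultimately show ?thesis by (simp add: algebra_simps)
qed

text \<open>The conserved quantity is the Hamiltonian divided by \<open>pi\<close>. The flow is
  \<open>-\<i>\<close> times the gradient, hence orthogonal to it.\<close>

lemma energy_conserved:
  assumes "coeff_flow s T N a" "t \<in> {0..T}"
  shows "kinetic s N (a t) - Re (quart N (a t) (a t) (a t) (a t)) / 2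
       = kinetic s N (a 0) - Re (quart N (a 0) (a 0) (a 0) (a 0)) / 2"
proof -
  let ?h = "\<lambda>\<tau>. complex_of_real (kinetic s N (a \<tau>)) - quart N (a \<tau>) (a \<tau>) (a \<tau>) (a \<tau>) / 2"
  have "(?h has_vector_derivative 0) (at t within {0..T})" if t: "t \<in> {0..T}" for t
  proof -
    let ?b = "a t" and ?z = "coeff_rhs s N (a t)"
    let ?Q = "quart N ?b ?b ?b ?z"
    have z: "((\<lambda>\<tau>. a \<tau> k) has_vector_derivative ?z k) (at t within {0..T})" if "k \<in> freqs N" for k
      using assms(1) t that by (auto simp: coeff_flow_def)
    have "(?h has_vector_derivative
        (\<Sum>k\<in>freqs N. of_real (\<bar>real_of_int k\<bar> powr (2 * s)) * (?z k * cnj (?b k) + ?b k * cnj (?z k)))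
        - 2 * (?Q + cnj ?Q) / 2) (at t within {0..T})"
      unfolding kinetic_def of_real_sum of_real_mult
      by (intro has_vector_derivative_diff has_vector_derivative_divide has_vector_derivative_sum
          has_vector_derivative_mult_right quart_has_vector_derivative cmod_sq_has_vector_derivative z)
    moreover have "(\<Sum>k\<in>freqs N. of_real (\<bar>real_of_int k\<bar> powr (2 * s)) * (?z k * cnj (?b k) + ?b k * cnj (?z k)))
        - 2 * (?Q + cnj ?Q) / 2 = 0"
    proof -
      \<comment> \<open>The cancellation takes place at each frequency: with \<open>x\<close> the
        multiplier, \<open>x * b - c = \<i> * z\<close>, and the expression is twice the real part
        of \<open>cnj z * (\<i> * z)\<close>, that is, \<open>0\<close>.\<close>
      have "of_real (\<bar>real_of_int k\<bar> powr (2 * s)) * (z * cnj b + b * cnj z) - (cnj z * c + z * cnj c) = 0"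
        if "z = - \<i> * of_real (\<bar>real_of_int k\<bar> powr (2 * s)) * b + \<i> * c" for z b c k
        unfolding that by (simp add: algebra_simps)
      from this[OF coeff_rhs_def] show ?thesis
        by (simp add: quart_def sum.distrib[symmetric] sum_subtractf[symmetric])
    qed
    ultimately show ?thesis by (simp only:)
  qed
  from eq_initial_if_has_vector_derivative_zero[OF this assms(2)] have "Re (?h t) = Re (?h 0)"
    by simp
  then show ?thesis by simp
qed

section \<open>The uniform bound for the absolute sum of the coefficients\<close>

lemma summable_on_int_powr:
  assumes "1/2 < s"
  shows "(\<lambda>k::int. 1 / (1 + \<bar>real_of_int k\<bar> powr (2 * s))) summable_on UNIV"
proof -
  let ?f = "\<lambda>k::int. 1 / (1 + \<bar>real_of_int k\<bar> powr (2 * s))"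
  have nat: "(\<lambda>n::nat. ?f (int n)) summable_on UNIV"
  proof (rule norm_summable_imp_summable_on)
    have "summable (\<lambda>n. real n powr (- (2 * s)))"
      using assms by (simp add: summable_real_powr_iff)
    then show "summable (\<lambda>n. norm (?f (int n)))"
    proof (rule summable_comparison_test')
      fix n :: nat assume "n \<ge> 1"
      then show "norm (norm (?f (int n))) \<le> real n powr (- (2 * s))"
        by (simp add: powr_minus field_simps add_nonneg_pos)
    qed
  qed
  have "?f summable_on range int"
    using nat by (subst summable_on_reindex) (auto simp: o_def)
  \<comment> \<open>Starting at \<open>1\<close> keeps the two images disjoint, so that
    \<open>0\<close> is counted once.\<close>
  moreover have "?f summable_on ((\<lambda>n. - int n) ` {1..})"
    using summable_on_subset_banach[OF nat, of "{1..}"]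
    by (subst summable_on_reindex) (auto simp: o_def inj_on_def)
  ultimately have "?f summable_on (range int \<union> (\<lambda>n. - int n) ` {1..})"
    by (intro summable_on_Un_disjoint) auto
  moreover have "range int \<union> (\<lambda>n. - int n) ` {1..} = UNIV"
  proof -
    have "k \<in> range int \<union> (\<lambda>n. - int n) ` {1..}" for k
    proof (cases "k \<ge> 0")
      case True
      then have "k = int (nat k)" by simp
      then show ?thesis by blast
    next
      case False
      then have "k = - int (nat (- k))" "nat (- k) \<in> {1..}" by auto
      then show ?thesis by blast
    qed
    then show ?thesis by blast
  qed
  ultimately show ?thesis by simp
qed

text \<open>A Sobolev embedding into absolutely convergent Fourier series: Cauchy-Schwarz splits off
  the weight \<open>1 + |k| powr (2 * s)\<close>, and the partial sums of its reciprocals stay below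
  the square of \<open>C_infty s\<close>.\<close>

lemma wnorm_0_sq_le:
  assumes "1/2 < s"
  shows "(wnorm 0 N a)\<^sup>2 \<le> (C_infty s)\<^sup>2 * (l2sq N a + kinetic s N a)"
proof -
  let ?l = "\<lambda>k. 1 + \<bar>real_of_int k\<bar> powr (2 * s)"
  have pos: "?l k > 0" for k by (simp add: add_pos_nonneg)
  have "(wnorm 0 N a)\<^sup>2 = (\<Sum>k\<in>freqs N. (1 / sqrt (?l k)) * (sqrt (?l k) * cmod (a k)))\<^sup>2"
    unfolding wnorm_def using pos by (intro arg_cong[where f="\<lambda>x. x\<^sup>2"] sum.cong) (auto simp: less_imp_neq[symmetric])
  also have "\<dots> \<le> (\<Sum>k\<in>freqs N. (1 / sqrt (?l k))\<^sup>2) * (\<Sum>k\<in>freqs N. (sqrt (?l k) * cmod (a k))\<^sup>2)"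
    by (rule Cauchy_Schwarz_ineq_sum)
  also have "(\<Sum>k\<in>freqs N. (1 / sqrt (?l k))\<^sup>2) = (\<Sum>k\<in>freqs N. 1 / ?l k)"
    using pos by (simp add: power_divide less_imp_le)
  also have "(\<Sum>k\<in>freqs N. (sqrt (?l k) * cmod (a k))\<^sup>2) = l2sq N a + kinetic s N a"
    unfolding l2sq_def kinetic_def sum.distrib[symmetric]
    using pos by (simp add: power_mult_distrib less_imp_le algebra_simps)
  also have "(\<Sum>k\<in>freqs N. 1 / ?l k) * (l2sq N a + kinetic s N a) \<le> (C_infty s)\<^sup>2 * (l2sq N a + kinetic s N a)"
  proof (rule mult_right_mono)
    have "(C_infty s)\<^sup>2 = (\<Sum>\<^sub>\<infinity>k::int. 1 / ?l k)"
      unfolding C_infty_def using pos by (intro real_sqrt_pow2 infsum_nonneg) (simp add: less_imp_le)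
    then show "(\<Sum>k\<in>freqs N. 1 / ?l k) \<le> (C_infty s)\<^sup>2"
      using finite_sum_le_infsum[OF summable_on_int_powr[OF assms], of "freqs N"] pos
      by (simp add: less_imp_le)
    show "l2sq N a + kinetic s N a \<ge> 0"
      unfolding l2sq_def kinetic_def by (intro add_nonneg_nonneg sum_nonneg) auto
  qed
  finally show ?thesis .
qed

text \<open>Smallness makes the quartic term at most \<open>?X\<close>. It enters the energy with
  the factor \<open>1/2\<close>, so half of \<open>?X t\<close> remains after absorption.\<close>

lemma wnorm_0_bounded:
  assumes s: "1/2 < s" and flow: "coeff_flow s T N a" and t: "t \<in> {0..T}"
    and small: "(C_infty s)\<^sup>2 * l2sq N (a 0) \<le> 1"
  shows "(wnorm 0 N (a t))\<^sup>2 \<le> 3 * (C_infty s)\<^sup>2 * (l2sq N (a 0) + kinetic s N (a 0))"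
proof -
  let ?X = "\<lambda>t. l2sq N (a t) + kinetic s N (a t)"
  let ?Q = "\<lambda>t. Re (quart N (a t) (a t) (a t) (a t))"
  have X: "?X t \<ge> 0" for t
    unfolding l2sq_def kinetic_def by (intro add_nonneg_nonneg sum_nonneg) auto
  have Q: "\<bar>?Q t\<bar> \<le> ?X t" if t: "t \<in> {0..T}" for t
  proof -
    have "\<bar>?Q t\<bar> \<le> (wnorm 0 N (a t))\<^sup>2 * l2sq N (a t)"
      using abs_Re_le_cmod norm_quart_le order_trans unfolding l2sq_def by blast
    also have "\<dots> \<le> ((C_infty s)\<^sup>2 * ?X t) * l2sq N (a t)"
      by (intro mult_right_mono wnorm_0_sq_le s) (simp add: l2sq_def sum_nonneg)
    also have "\<dots> = ((C_infty s)\<^sup>2 * l2sq N (a 0)) * ?X t"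
      using l2sq_conserved[OF flow t] by (simp add: mult_ac)
    also have "\<dots> \<le> 1 * ?X t"
      by (intro mult_right_mono small X)
    finally show ?thesis by simp
  qed
  \<comment> \<open>The conservation laws give
    \<open>?X t = ?X 0 + (?Q t - ?Q 0) / 2 <= 3/2 * ?X 0 + ?X t / 2\<close>.\<close>
  have "?X t \<le> 3 * ?X 0"
    using Q[OF t] Q[of 0] t energy_conserved[OF flow t] l2sq_conserved[OF flow t] X[of t]
    by (auto simp: abs_le_iff)
  then have "(C_infty s)\<^sup>2 * ?X t \<le> (C_infty s)\<^sup>2 * (3 * ?X 0)"
    by (intro mult_left_mono) auto
  with wnorm_0_sq_le[OF s, of N "a t"] show ?thesis by (simp add: algebra_simps)
qed

lemma sum_power2_le:
  fixes f :: "'a \<Rightarrow> real"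
  assumes "finite A" "\<And>x. x \<in> A \<Longrightarrow> f x \<ge> 0"
  shows "(\<Sum>x\<in>A. (f x)\<^sup>2) \<le> (sum f A)\<^sup>2"
  unfolding power2_eq_square sum_distrib_right
  using assms by (intro sum_mono mult_left_mono member_le_sum) auto

text \<open>A crude bound, applied to the initial value only, where smoothness of the data makes
  \<open>wnorm 2\<close> bounded uniformly in \<open>N\<close>.\<close>

lemma l2sq_add_kinetic_le:
  assumes "s \<le> 1" "s > 0"
  shows "l2sq N a + kinetic s N a \<le> (wnorm 2 N a)\<^sup>2"
proof -
  have "1 + \<bar>real_of_int k\<bar> powr (2 * s) \<le> ((1 + \<bar>real_of_int k\<bar>)\<^sup>2)\<^sup>2" for k
  proof -
    have "\<bar>real_of_int k\<bar> powr (2 * s) \<le> \<bar>real_of_int k\<bar>\<^sup>2"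
    proof (cases "k = 0")
      case False
      then have "\<bar>real_of_int k\<bar> powr (2 * s) \<le> \<bar>real_of_int k\<bar> powr 2"
        using assms by (intro powr_mono) auto
      then show ?thesis using False by simp
    qed auto
    moreover have "1 + \<bar>real_of_int k\<bar>\<^sup>2 \<le> (1 + \<bar>real_of_int k\<bar>)\<^sup>2"
      by (simp add: power2_sum)
    moreover have "(1 + \<bar>real_of_int k\<bar>)\<^sup>2 * 1 \<le> (1 + \<bar>real_of_int k\<bar>)\<^sup>2 * (1 + \<bar>real_of_int k\<bar>)\<^sup>2"
      by (intro mult_left_mono) auto
    ultimately show ?thesis by (simp add: power2_eq_square)
  qed
  then have "(\<Sum>k\<in>freqs N. (1 + \<bar>real_of_int k\<bar> powr (2 * s)) * (cmod (a k))\<^sup>2)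
      \<le> (\<Sum>k\<in>freqs N. ((1 + \<bar>real_of_int k\<bar>)\<^sup>2)\<^sup>2 * (cmod (a k))\<^sup>2)"
    by (intro sum_mono mult_right_mono) auto
  then have "l2sq N a + kinetic s N a \<le> (\<Sum>k\<in>freqs N. ((1 + \<bar>real_of_int k\<bar>)\<^sup>2)\<^sup>2 * (cmod (a k))\<^sup>2)"
    unfolding l2sq_def kinetic_def sum.distrib[symmetric] by (simp only: distrib_right mult_1_left)
  also have "\<dots> \<le> (wnorm 2 N a)\<^sup>2"
    unfolding wnorm_def power_mult_distrib[symmetric] 
    by (intro sum_power2_le) auto
  finally show ?thesis .
qed

text \<open>The square roots are regularised so that the weighted \<open>\<ell>\<^sup>1\<close> norm becomes differentiable
  in time; the regularisation may depend on \<open>N\<close>.\<close>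

lemma wnorm_gronwall:
  assumes flow: "coeff_flow s T N a" and t: "t \<in> {0..T}"
    and B: "\<And>t. t \<in> {0..T} \<Longrightarrow> (wnorm 0 N (a t))\<^sup>2 \<le> B"
  shows "wnorm m N (a t) \<le> exp (3 * 3 ^ m * B * T) * (wnorm m N (a 0) + 1)"
proof -
  let ?I = "freqs N"
  define w where "w = (\<lambda>k. (1 + \<bar>real_of_int k\<bar>) ^ m)"
  have w: "w k \<ge> 0" for k by (simp add: w_def)
  have wn: "wnorm m N c = (\<Sum>k\<in>?I. w k * cmod (c k))" for c
    by (simp add: wnorm_def w_def)
  define L where "L = 3 * 3 ^ m * B"
  \<comment> \<open>Chosen so that the regularisation raises the weighted sum by at most
    \<open>1\<close>.\<close>
  define \<delta> where "\<delta> = 1 / (1 + (\<Sum>k\<in>?I. w k))"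
  have W: "(\<Sum>k\<in>?I. w k) \<ge> 0" by (intro sum_nonneg w)
  have \<delta>: "\<delta> > 0" "(\<Sum>k\<in>?I. w k) * \<delta> \<le> 1"
    using W by (simp_all add: \<delta>_def add_pos_nonneg field_simps)
  have B0: "B \<ge> 0" using B[OF t] by (smt (verit) zero_le_power2)
  define r where "r = (\<lambda>\<tau> k. sqrt ((cmod (a \<tau> k))\<^sup>2 + \<delta>\<^sup>2))"
  have r: "r \<tau> k > 0" "cmod (a \<tau> k) \<le> r \<tau> k" "r \<tau> k \<le> cmod (a \<tau> k) + \<delta>" for \<tau> k
    using \<delta>(1) sqrt_sum_squares_le_sum[of "cmod (a \<tau> k)" \<delta>]
    by (auto simp: r_def add_nonneg_pos intro!: real_le_rsqrt)
  define y where "y = (\<lambda>\<tau>. \<Sum>k\<in>?I. w k * r \<tau> k)"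
  define c where "c = (\<lambda>\<tau>. tri N (a \<tau>) (a \<tau>) (a \<tau>))"
  define y' where "y' = (\<lambda>\<tau>. \<Sum>k\<in>?I. w k * (Re (\<i> * c \<tau> k * cnj (a \<tau> k)) / r \<tau> k))"
  have der: "(y has_real_derivative y' \<tau>) (at \<tau> within {0..T})" if \<tau>: "\<tau> \<in> {0..T}" for \<tau>
    unfolding y_def y'_def
  proof (intro DERIV_sum DERIV_cmult)
    fix k assume k: "k \<in> ?I"
    let ?z = "coeff_rhs s N (a \<tau>) k"
    have "((\<lambda>\<tau>. complex_of_real ((cmod (a \<tau> k))\<^sup>2)) has_vector_derivative
        ?z * cnj (a \<tau> k) + a \<tau> k * cnj ?z) (at \<tau> within {0..T})"
      using flow \<tau> k by (intro cmod_sq_has_vector_derivative) (auto simp: coeff_flow_def)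
    from bounded_linear.has_vector_derivative[OF bounded_linear_Re this]
    have "((\<lambda>\<tau>. (cmod (a \<tau> k))\<^sup>2) has_real_derivative Re (?z * cnj (a \<tau> k) + a \<tau> k * cnj ?z)) (at \<tau> within {0..T})"
      by (simp add: has_real_derivative_iff_has_vector_derivative)
    \<comment> \<open>The multiplier term is \<open>-\<i>\<close> times a real number here and drops
      out; hence no power of the weight is lost.\<close>
    moreover have "Re (?z * cnj (a \<tau> k) + a \<tau> k * cnj ?z) = 2 * Re (\<i> * c \<tau> k * cnj (a \<tau> k))"
      by (simp add: coeff_rhs_def c_def algebra_simps)
    ultimately have "((\<lambda>\<tau>. (cmod (a \<tau> k))\<^sup>2) has_real_derivative 2 * Re (\<i> * c \<tau> k * cnj (a \<tau> k))) (at \<tau> within {0..T})"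
      by (simp only:)
    from DERIV_add[OF this DERIV_const[of "\<delta>\<^sup>2"]]
    have "((\<lambda>\<tau>. (cmod (a \<tau> k))\<^sup>2 + \<delta>\<^sup>2) has_real_derivative 2 * Re (\<i> * c \<tau> k * cnj (a \<tau> k))) (at \<tau> within {0..T})"
      by (simp only: add_0_right)
    moreover have "(cmod (a \<tau> k))\<^sup>2 + \<delta>\<^sup>2 > 0" using \<delta> by (simp add: add_nonneg_pos)
    ultimately have "((\<lambda>\<tau>. sqrt ((cmod (a \<tau> k))\<^sup>2 + \<delta>\<^sup>2)) has_real_derivative
        inverse (sqrt ((cmod (a \<tau> k))\<^sup>2 + \<delta>\<^sup>2)) / 2 * (2 * Re (\<i> * c \<tau> k * cnj (a \<tau> k)))) (at \<tau> within {0..T})"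
      by (intro DERIV_chain2[OF DERIV_real_sqrt])
    then show "((\<lambda>\<tau>. r \<tau> k) has_real_derivative Re (\<i> * c \<tau> k * cnj (a \<tau> k)) / r \<tau> k) (at \<tau> within {0..T})"
      unfolding r_def
    proof (rule DERIV_cong)
      have "inverse x / 2 * (2 * y) = y / x" for x y :: real by (simp add: field_simps)
      then show "inverse (sqrt ((cmod (a \<tau> k))\<^sup>2 + \<delta>\<^sup>2)) / 2 * (2 * Re (\<i> * c \<tau> k * cnj (a \<tau> k)))
          = Re (\<i> * c \<tau> k * cnj (a \<tau> k)) / sqrt ((cmod (a \<tau> k))\<^sup>2 + \<delta>\<^sup>2)" .
    qed
  qed
  have y'_le: "y' \<tau> \<le> L * y \<tau>" if \<tau>: "\<tau> \<in> {0..T}" for \<tau>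
  proof -
    have "Re (\<i> * c \<tau> k * cnj (a \<tau> k)) / r \<tau> k \<le> cmod (c \<tau> k)" for k
    proof -
      have "Re (\<i> * c \<tau> k * cnj (a \<tau> k)) \<le> cmod (c \<tau> k) * cmod (a \<tau> k)"
        using complex_Re_le_cmod[of "\<i> * c \<tau> k * cnj (a \<tau> k)"] by (simp add: norm_mult)
      also have "\<dots> \<le> cmod (c \<tau> k) * r \<tau> k"
        by (intro mult_left_mono r) auto
      finally show ?thesis using r(1)[of \<tau> k] by (simp add: divide_le_eq)
    qed
    then have "y' \<tau> \<le> wnorm m N (c \<tau>)"
      unfolding y'_def wn by (intro sum_mono mult_left_mono w)
    also have "\<dots> \<le> 3 * 3 ^ m * (wnorm 0 N (a \<tau>))\<^sup>2 * wnorm m N (a \<tau>)"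
      unfolding c_def by (rule wnorm_tri_tame)
    also have "\<dots> \<le> L * wnorm m N (a \<tau>)"
      unfolding L_def by (intro mult_right_mono mult_left_mono B \<tau> wnorm_nonneg) auto
    also have "\<dots> \<le> L * y \<tau>"
      unfolding wn y_def using B0 by (intro mult_left_mono sum_mono r w) (auto simp: L_def)
    finally show ?thesis .
  qed
  \<comment> \<open>Integrating factor: by \<open>y'_le\<close> the derivative of \<open>z\<close>
    is nonpositive.\<close>
  define z where "z = (\<lambda>\<tau>. y \<tau> * exp (- L * \<tau>))"
  have zder: "(z has_real_derivative (y' \<tau> - L * y \<tau>) * exp (- L * \<tau>)) (at \<tau> within {0..T})" if \<tau>: "\<tau> \<in> {0..T}" for \<tau>
    unfolding z_def by (auto intro!: derivative_eq_intros der \<tau> simp: algebra_simps)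
  have "z t \<le> z 0"
  proof (rule DERIV_nonpos_imp_decreasing_open[of 0 t z])
    show "0 \<le> t" using t by simp
    show "\<exists>l. DERIV z \<tau> :> l \<and> l \<le> 0" if "0 < \<tau>" "\<tau> < t" for \<tau>
    proof -
      \<comment> \<open>At interior points the derivative within the interval is two-sided, and
        monotonicity asks for no more; at the endpoints continuity suffices.\<close>
      have \<tau>: "\<tau> \<in> {0<..<T}" using that t by auto
      then have "at \<tau> within {0..T} = at \<tau>"
        by (intro at_within_interior) auto
      with zder[of \<tau>] \<tau> have "DERIV z \<tau> :> (y' \<tau> - L * y \<tau>) * exp (- L * \<tau>)" by auto
      moreover have "(y' \<tau> - L * y \<tau>) * exp (- L * \<tau>) \<le> 0"
        using y'_le[of \<tau>] \<tau> by (intro mult_nonpos_nonneg) auto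
      ultimately show ?thesis by blast
    qed
    have "continuous_on {0..T} z"
      using zder by (rule DERIV_continuous_on)
    then show "continuous_on {0..t} z" by (rule continuous_on_subset) (use t in auto)
  qed
  then have "y t \<le> exp (L * t) * y 0"
    by (simp add: z_def exp_minus field_simps)
  also have "\<dots> \<le> exp (L * T) * (wnorm m N (a 0) + 1)"
  proof (intro mult_mono)
    show "exp (L * t) \<le> exp (L * T)"
      using t B0 by (simp add: L_def mult_left_mono)
    have "y 0 \<le> (\<Sum>k\<in>?I. w k * (cmod (a 0 k) + \<delta>))"
      unfolding y_def by (intro sum_mono mult_left_mono r w)
    also have "\<dots> \<le> wnorm m N (a 0) + 1"
      using \<delta>(2) by (simp add: wn distrib_left sum.distrib sum_distrib_right)
    finally show "y 0 \<le> wnorm m N (a 0) + 1" .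
    show "y 0 \<ge> 0" unfolding y_def using r(1) by (intro sum_nonneg mult_nonneg_nonneg w less_imp_le)
  qed auto
  also have "wnorm m N (a t) \<le> y t"
    unfolding wn y_def by (intro mult_left_mono sum_mono r w)
  finally (xtrans) show ?thesis by (simp add: L_def)
qed

section \<open>Time derivatives\<close>

definition bounded_family ::
  "real \<Rightarrow> nat set \<Rightarrow> (nat \<Rightarrow> real \<Rightarrow> int \<Rightarrow> complex) \<Rightarrow> bool" where
  "bounded_family T A f \<longleftrightarrow> (\<forall>m. \<exists>C. \<forall>N\<in>A. \<forall>t\<in>{0..T}. wnorm m N (f N t) \<le> C)"

text \<open>Derivatives are existential witnesses on \<open>freqs N\<close> instead of values of
  \<open>vector_derivative\<close>, so that the closure lemmas can supply them by formulas.\<close>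

primrec bounded_derivs ::
  "real \<Rightarrow> nat set \<Rightarrow> nat \<Rightarrow> (nat \<Rightarrow> real \<Rightarrow> int \<Rightarrow> complex) \<Rightarrow> bool" where
  "bounded_derivs T A 0 f \<longleftrightarrow> bounded_family T A f"
| "bounded_derivs T A (Suc j) f \<longleftrightarrow> bounded_family T A f \<and> (\<exists>f'. bounded_derivs T A j f' \<and>
     (\<forall>N\<in>A. \<forall>t\<in>{0..T}. \<forall>k\<in>freqs N.
        ((\<lambda>\<tau>. f N \<tau> k) has_vector_derivative f' N t k) (at t within {0..T})))"

lemma bounded_derivs_imp_bounded_family: "bounded_derivs T A j f \<Longrightarrow> bounded_family T A f"
  by (cases j) auto

lemma bounded_derivs_SucI:
  assumes "bounded_family T A f" "bounded_derivs T A j f'"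
    and "\<And>N t k. N \<in> A \<Longrightarrow> t \<in> {0..T} \<Longrightarrow> k \<in> freqs N \<Longrightarrow>
      ((\<lambda>\<tau>. f N \<tau> k) has_vector_derivative f' N t k) (at t within {0..T})"
  shows "bounded_derivs T A (Suc j) f"
  unfolding bounded_derivs.simps using assms by blast

lemma bounded_derivs_SucE:
  assumes "bounded_derivs T A (Suc j) f"
  obtains f' where "bounded_derivs T A j f'"
    and "\<And>N t k. N \<in> A \<Longrightarrow> t \<in> {0..T} \<Longrightarrow> k \<in> freqs N \<Longrightarrow>
      ((\<lambda>\<tau>. f N \<tau> k) has_vector_derivative f' N t k) (at t within {0..T})"
  using assms unfolding bounded_derivs.simps by blast

lemma bounded_derivs_Suc: "bounded_derivs T A (Suc j) f \<Longrightarrow> bounded_derivs T A j f"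
proof (induction j arbitrary: f)
  case (Suc j)
  obtain f' where f': "bounded_derivs T A (Suc j) f'"
    "\<And>N t k. N \<in> A \<Longrightarrow> t \<in> {0..T} \<Longrightarrow> k \<in> freqs N \<Longrightarrow>
      ((\<lambda>\<tau>. f N \<tau> k) has_vector_derivative f' N t k) (at t within {0..T})"
    using bounded_derivs_SucE[OF Suc.prems] by metis
  then show ?case
    using bounded_derivs_imp_bounded_family[OF Suc.prems] Suc.IH by (intro bounded_derivs_SucI)
qed simp

section \<open>Closure under sums, cubic convolutions and multipliers\<close>

lemma bounded_family_add:
  assumes "bounded_family T A f" "bounded_family T A g"
  shows "bounded_family T A (\<lambda>N t k. f N t k + g N t k)"
  unfolding bounded_family_def
proof
  fix m
  obtain C where "\<forall>N\<in>A. \<forall>t\<in>{0..T}. wnorm m N (f N t) \<le> C"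
    using assms(1) unfolding bounded_family_def by blast
  moreover obtain D where "\<forall>N\<in>A. \<forall>t\<in>{0..T}. wnorm m N (g N t) \<le> D"
    using assms(2) unfolding bounded_family_def by blast
  ultimately show "\<exists>C. \<forall>N\<in>A. \<forall>t\<in>{0..T}. wnorm m N (\<lambda>k. f N t k + g N t k) \<le> C"
    by (intro exI[of _ "C + D"] ballI order_trans[OF wnorm_add] add_mono) auto
qed

lemma bounded_family_tri:
  assumes "bounded_family T A f" "bounded_family T A g" "bounded_family T A h"
  shows "bounded_family T A (\<lambda>N t. tri N (f N t) (g N t) (h N t))"
  unfolding bounded_family_def
proof
  fix m
  obtain C where "\<forall>N\<in>A. \<forall>t\<in>{0..T}. wnorm m N (f N t) \<le> C"
    using assms(1) unfolding bounded_family_def by blast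
  moreover obtain D where "\<forall>N\<in>A. \<forall>t\<in>{0..T}. wnorm m N (g N t) \<le> D"
    using assms(2) unfolding bounded_family_def by blast
  moreover obtain E where "\<forall>N\<in>A. \<forall>t\<in>{0..T}. wnorm m N (h N t) \<le> E"
    using assms(3) unfolding bounded_family_def by blast
  \<comment> \<open>\<open>max 0\<close> provides the signs needed to multiply inequalities; the
    constants alone carry none if there is no \<open>N\<close> or \<open>t\<close>.\<close>
  ultimately have "wnorm m N (tri N (f N t) (g N t) (h N t)) \<le> max 0 C * max 0 D * max 0 E"
    if "N \<in> A" "t \<in> {0..T}" for N t
    using that by (intro order_trans[OF wnorm_tri] mult_mono mult_nonneg_nonneg wnorm_nonneg) (auto simp: le_max_iff_disj)
  then show "\<exists>C. \<forall>N\<in>A. \<forall>t\<in>{0..T}. wnorm m N (tri N (f N t) (g N t) (h N t)) \<le> C"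
    by blast
qed

lemma bounded_family_multiplier:
  assumes "\<And>k. cmod (g k) \<le> (1 + \<bar>real_of_int k\<bar>) ^ n" and "bounded_family T A f"
  shows "bounded_family T A (\<lambda>N t k. g k * f N t k)"
  unfolding bounded_family_def
proof
  fix m
  obtain C where "\<forall>N\<in>A. \<forall>t\<in>{0..T}. wnorm (m + n) N (f N t) \<le> C"
    using assms(2) unfolding bounded_family_def by blast
  then show "\<exists>C. \<forall>N\<in>A. \<forall>t\<in>{0..T}. wnorm m N (\<lambda>k. g k * f N t k) \<le> C"
    by (intro exI[of _ C] ballI order_trans[OF wnorm_multiplier[OF assms(1)]]) auto
qed

lemma bounded_derivs_multiplier:
  assumes "\<And>k. cmod (g k) \<le> (1 + \<bar>real_of_int k\<bar>) ^ n" and "bounded_derivs T A j f"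
  shows "bounded_derivs T A j (\<lambda>N t k. g k * f N t k)"
  using assms(2)
proof (induction j arbitrary: f)
  case (0 f)
  then show ?case
    using bounded_family_multiplier[OF assms(1)] by simp
next
  case (Suc j f)
  have bdd: "bounded_family T A (\<lambda>N t k. g k * f N t k)"
    by (rule bounded_family_multiplier[OF assms(1) bounded_derivs_imp_bounded_family[OF Suc.prems]])
  obtain f' where f': "bounded_derivs T A j f'"
    "\<And>N t k. N \<in> A \<Longrightarrow> t \<in> {0..T} \<Longrightarrow> k \<in> freqs N \<Longrightarrow>
      ((\<lambda>\<tau>. f N \<tau> k) has_vector_derivative f' N t k) (at t within {0..T})"
    using bounded_derivs_SucE[OF Suc.prems] by metis
  show ?case
    by (rule bounded_derivs_SucI[OF bdd], rule Suc.IH[OF f'(1)]) (intro has_vector_derivative_mult_right f'(2))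
qed

lemma bounded_derivs_add:
  assumes "bounded_derivs T A j f" "bounded_derivs T A j g"
  shows "bounded_derivs T A j (\<lambda>N t k. f N t k + g N t k)"
  using assms
proof (induction j arbitrary: f g)
  case (Suc j f g)
  obtain f' where f': "bounded_derivs T A j f'"
    "\<And>N t k. N \<in> A \<Longrightarrow> t \<in> {0..T} \<Longrightarrow> k \<in> freqs N \<Longrightarrow>
      ((\<lambda>\<tau>. f N \<tau> k) has_vector_derivative f' N t k) (at t within {0..T})"
    using bounded_derivs_SucE[OF Suc.prems(1)] by metis
  obtain g' where g': "bounded_derivs T A j g'"
    "\<And>N t k. N \<in> A \<Longrightarrow> t \<in> {0..T} \<Longrightarrow> k \<in> freqs N \<Longrightarrow>
      ((\<lambda>\<tau>. g N \<tau> k) has_vector_derivative g' N t k) (at t within {0..T})"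
    using bounded_derivs_SucE[OF Suc.prems(2)] by metis
  show ?case
    by (rule bounded_derivs_SucI, rule bounded_family_add[OF Suc.prems[THEN bounded_derivs_imp_bounded_family]],
        rule Suc.IH[OF f'(1) g'(1)]) (intro has_vector_derivative_add f'(2) g'(2))
qed (auto intro: bounded_family_add)

text \<open>The derivative is a sum of three cubic convolutions, each with one differentiated
  factor. The other two factors are lowered to level \<open>j\<close> by
  \<open>bounded_derivs_Suc\<close>, and the induction hypothesis applies to each summand.\<close>

lemma bounded_derivs_tri:
  assumes "bounded_derivs T A j f" "bounded_derivs T A j g" "bounded_derivs T A j h"
  shows "bounded_derivs T A j (\<lambda>N t. tri N (f N t) (g N t) (h N t))"
  using assms
proof (induction j arbitrary: f g h)
  case (Suc j f g h)
  obtain f' where f': "bounded_derivs T A j f'"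
    "\<And>N t k. N \<in> A \<Longrightarrow> t \<in> {0..T} \<Longrightarrow> k \<in> freqs N \<Longrightarrow>
      ((\<lambda>\<tau>. f N \<tau> k) has_vector_derivative f' N t k) (at t within {0..T})"
    using bounded_derivs_SucE[OF Suc.prems(1)] by metis
  obtain g' where g': "bounded_derivs T A j g'"
    "\<And>N t k. N \<in> A \<Longrightarrow> t \<in> {0..T} \<Longrightarrow> k \<in> freqs N \<Longrightarrow>
      ((\<lambda>\<tau>. g N \<tau> k) has_vector_derivative g' N t k) (at t within {0..T})"
    using bounded_derivs_SucE[OF Suc.prems(2)] by metis
  obtain h' where h': "bounded_derivs T A j h'"
    "\<And>N t k. N \<in> A \<Longrightarrow> t \<in> {0..T} \<Longrightarrow> k \<in> freqs N \<Longrightarrow>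
      ((\<lambda>\<tau>. h N \<tau> k) has_vector_derivative h' N t k) (at t within {0..T})"
    using bounded_derivs_SucE[OF Suc.prems(3)] by metis
  let ?D = "\<lambda>N t k. tri N (f' N t) (g N t) (h N t) k + tri N (f N t) (g' N t) (h N t) k
    + tri N (f N t) (g N t) (h' N t) k"
  have "bounded_derivs T A j ?D"
    using Suc.prems[THEN bounded_derivs_Suc] f'(1) g'(1) h'(1)
    by (intro bounded_derivs_add Suc.IH)
  moreover have "((\<lambda>\<tau>. tri N (f N \<tau>) (g N \<tau>) (h N \<tau>) k) has_vector_derivative ?D N t k) (at t within {0..T})"
    if "N \<in> A" "t \<in> {0..T}" for N t k
    using that f'(2) g'(2) h'(2) by (intro tri_has_vector_derivative) auto
  ultimately show ?case
    using bounded_family_tri[OF Suc.prems[THEN bounded_derivs_imp_bounded_family]]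
    by (intro bounded_derivs_SucI[where f' = ?D]) simp_all
qed (auto intro: bounded_family_tri)

text \<open>Bootstrapping: if \<open>a\<close> has \<open>j\<close> bounded derivatives, so does the
  right-hand side of its equation, which is the derivative of \<open>a\<close>. As
  \<open>2 * s <= 2\<close>, the multiplier has order \<open>2\<close>.\<close>

lemma bounded_derivs_flow:
  assumes s: "s > 0" "s \<le> 1" and bdd: "bounded_family T A a"
    and flow: "\<And>N. N \<in> A \<Longrightarrow> coeff_flow s T N (a N)"
  shows "bounded_derivs T A j a"
proof (induction j)
  case (Suc j)
  let ?g = "\<lambda>k::int. - \<i> * of_real (\<bar>real_of_int k\<bar> powr (2 * s))"
  have g: "cmod (?g k) \<le> (1 + \<bar>real_of_int k\<bar>) ^ 2" for k
  proof (cases "k = 0")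
    case False
    have "\<bar>real_of_int k\<bar> powr (2 * s) \<le> \<bar>real_of_int k\<bar> powr 2"
      using s False by (intro powr_mono) auto
    also have "\<dots> \<le> (1 + \<bar>real_of_int k\<bar>) ^ 2"
      using False by (simp add: power2_sum)
    finally show ?thesis by (simp add: norm_mult)
  qed auto
  have "bounded_derivs T A j (\<lambda>N t k. ?g k * a N t k + \<i> * tri N (a N t) (a N t) (a N t) k)"
    by (intro bounded_derivs_add bounded_derivs_multiplier[OF g] bounded_derivs_tri Suc
        bounded_derivs_multiplier[where g = "\<lambda>_. \<i>" and n = 0]) simp
  then have "bounded_derivs T A j (\<lambda>N t. coeff_rhs s N (a N t))"
    by (simp add: coeff_rhs_def[abs_def])
  then show ?case
    by (rule bounded_derivs_SucI[OF bdd]) (use flow coeff_flow_def in blast)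
qed (use bdd in simp)

text \<open>Induction with \<open>f\<close> and \<open>v\<close> arbitrary: differentiating a curve
  of trigonometric polynomials yields another one, with the witness \<open>f'\<close> as
  coefficients, to which the hypothesis for \<open>j\<close> applies.\<close>

lemma time_deriv_funpow:
  assumes T: "T > 0"
    and "bounded_derivs T A j f"
    and "\<And>N t. N \<in> A \<Longrightarrow> t \<in> {0..T} \<Longrightarrow> v N t = trig_sum N (f N t)"
  shows "\<exists>f'. bounded_family T A f' \<and>
    (\<forall>N\<in>A. \<forall>t\<in>{0..T}. (time_deriv T ^^ j) (v N) t = trig_sum N (f' N t))"
  using assms(2,3)
proof (induction j arbitrary: f v)
  case (Suc j f v)
  obtain f' where f': "bounded_derivs T A j f'"
    "\<And>N t k. N \<in> A \<Longrightarrow> t \<in> {0..T} \<Longrightarrow> k \<in> freqs N \<Longrightarrow>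
      ((\<lambda>\<tau>. f N \<tau> k) has_vector_derivative f' N t k) (at t within {0..T})"
    using bounded_derivs_SucE[OF Suc.prems(1)] by metis
  have "time_deriv T (v N) t = trig_sum N (f' N t)" if N: "N \<in> A" and t: "t \<in> {0..T}" for N t
  proof
    fix x
    have "((\<lambda>\<tau>. trig_sum N (f N \<tau>) x) has_vector_derivative trig_sum N (f' N t) x) (at t within {0..T})"
      unfolding trig_sum_def using f'(2) N t
      by (intro has_vector_derivative_sum has_vector_derivative_mult_left) auto
    then have "((\<lambda>\<tau>. v N \<tau> x) has_vector_derivative trig_sum N (f' N t) x) (at t within {0..T})"
      by (rule has_vector_derivative_transform[OF t, rotated]) (simp add: Suc.prems(2) N)
    \<comment> \<open>Because \<open>T > 0\<close>, derivatives within the closed interval are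
      unique, also at its endpoints.\<close>
    then show "time_deriv T (v N) t x = trig_sum N (f' N t) x"
      unfolding time_deriv_def using T t
      by (intro vector_derivative_within_closed_interval)
  qed
  from Suc.IH[OF f'(1), of "\<lambda>N. time_deriv T (v N)", OF this] show ?case
    by (simp add: funpow_swap1)
qed auto

text \<open>The norm estimate combines \<open>1 + k^2 <= (1 + |k|)^2\<close> with the fact that a
  square sum is at most the square of the absolute sum.\<close>

lemma trig_sum_Sobolev:
  shows "trig_sum N c \<in> Sobolev \<mu>"
    and "sobolev_norm (real l) (trig_sum N c) \<le> wnorm l N c"
proof -
  have cont: "continuous_on UNIV (trig_sum N c)"
    by (rule continuous_on_trig_sum)
  have meas: "trig_sum N c \<in> borel_measurable lebesgue"
    using borel_measurable_continuous_onI[OF cont] by (simp add: measurable_completion)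
  have int: "set_integrable lebesgue {-pi..pi} (\<lambda>x. (cmod (trig_sum N c x))\<^sup>2)"
    by (intro absolutely_integrable_continuous_real continuous_intros)
  have "(\<lambda>k. (1 + (real_of_int k)\<^sup>2) powr \<mu> * (cmod (fourier (trig_sum N c) k))\<^sup>2) summable_on UNIV \<longleftrightarrow>
    (\<lambda>k. (1 + (real_of_int k)\<^sup>2) powr \<mu> * (cmod (fourier (trig_sum N c) k))\<^sup>2) summable_on freqs N"
    by (rule summable_on_cong_neutral) (auto simp: fourier_trig_sum)
  then show "trig_sum N c \<in> Sobolev \<mu>"
    using periodic_trig_sum meas int by (simp add: Sobolev_def)
  have "(\<Sum>\<^sub>\<infinity>k. (1 + (real_of_int k)\<^sup>2) powr real l * (cmod (fourier (trig_sum N c) k))\<^sup>2)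
    = (\<Sum>\<^sub>\<infinity>k\<in>freqs N. (1 + (real_of_int k)\<^sup>2) powr real l * (cmod (c k))\<^sup>2)"
    by (rule infsum_cong_neutral) (auto simp: fourier_trig_sum)
  also have "\<dots> = (\<Sum>k\<in>freqs N. (1 + (real_of_int k)\<^sup>2) powr real l * (cmod (c k))\<^sup>2)"
    by simp
  also have "\<dots> \<le> (\<Sum>k\<in>freqs N. ((1 + \<bar>real_of_int k\<bar>) ^ l * cmod (c k))\<^sup>2)"
  proof (rule sum_mono)
    fix k
    have "(1 + (real_of_int k)\<^sup>2) powr real l = (1 + (real_of_int k)\<^sup>2) ^ l"
      by (intro powr_realpow) (simp add: add_pos_nonneg)
    also have "\<dots> \<le> ((1 + \<bar>real_of_int k\<bar>)\<^sup>2) ^ l"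
      by (intro power_mono) (auto simp: power2_sum)
    finally show "(1 + (real_of_int k)\<^sup>2) powr real l * (cmod (c k))\<^sup>2 \<le> ((1 + \<bar>real_of_int k\<bar>) ^ l * cmod (c k))\<^sup>2"
      unfolding power_mult_distrib by (intro mult_right_mono) (auto simp: power_mult[symmetric] mult.commute)
  qed
  also have "\<dots> \<le> (wnorm l N c)\<^sup>2"
    unfolding wnorm_def by (intro sum_power2_le) auto
  finally show "sobolev_norm (real l) (trig_sum N c) \<le> wnorm l N c"
    unfolding sobolev_norm_def by (intro real_le_lsqrt wnorm_nonneg)
qed

section \<open>Fourier coefficients of smooth functions\<close>

text \<open>Integration by parts; the boundary terms cancel by periodicity.\<close>

lemma fourier_deriv:
  assumes der: "\<And>x. (u has_vector_derivative u' x) (at x)" and cont: "continuous_on UNIV u'" and per: "periodic u"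
  shows "fourier u' k = \<i> * of_int k * fourier u k"
proof -
  have contu: "continuous_on S u" for S
    using der by (intro continuous_at_imp_continuous_on) (auto dest: has_vector_derivative_continuous)
  have contu': "continuous_on S u'" for S
    using cont continuous_on_subset by blast
  let ?e = "expo (- k)"
  have "((\<lambda>x. u x * (\<i> * of_int (- k) * ?e x) + u' x * ?e x) has_integral u pi * ?e pi - u (-pi) * ?e (-pi)) {-pi..pi}"
  proof (rule fundamental_theorem_of_calculus)
    fix x
    show "((\<lambda>x. u x * ?e x) has_vector_derivative u x * (\<i> * of_int (- k) * ?e x) + u' x * ?e x) (at x within {-pi..pi})"
      by (intro has_vector_derivative_mult expo_has_vector_derivative has_vector_derivative_at_within[OF der])
  qed simp
  moreover have "u pi * ?e pi = u (-pi) * ?e (-pi)"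
    using per expo_periodic[of "-k" "-pi"] by (auto simp: periodic_def dest: spec[of _ "-pi"])
  ultimately have "integral {-pi..pi} (\<lambda>x. - (\<i> * of_int k) * (u x * ?e x) + u' x * ?e x) = 0"
    by (simp add: integral_unique algebra_simps)
  then have "- (\<i> * of_int k) * integral {-pi..pi} (\<lambda>x. u x * ?e x) + integral {-pi..pi} (\<lambda>x. u' x * ?e x) = 0"
    by (subst (asm) integral_add)
       (auto intro!: integrable_continuous_interval continuous_intros contu contu')
  then show ?thesis
    by (simp add: fourier_eq_integral contu contu' algebra_simps)
qed

lemma fourier_le:
  assumes "continuous_on {-pi..pi} u" and "\<And>x. x \<in> {-pi..pi} \<Longrightarrow> cmod (u x) \<le> B"
  shows "cmod (fourier u k) \<le> B"
proof -
  have "cmod (integral {-pi..pi} (\<lambda>x. u x * expo (- k) x)) \<le> B * (pi - (- pi))"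
    by (intro integral_bound continuous_intros assms) (auto simp: norm_mult assms(2))
  then show ?thesis
    by (simp add: fourier_eq_integral[OF assms(1)] norm_mult norm_divide field_simps)
qed

text \<open>Induction on \<open>n\<close> for all derivatives \<open>D i\<close> simultaneously: one
  more factor \<open>1 + |k|\<close> is paid for by one more derivative.\<close>

lemma smooth_fourier_decay:
  assumes "smooth u" "periodic u"
  shows "\<exists>C. \<forall>k. (1 + \<bar>real_of_int k\<bar>) ^ n * cmod (fourier u k) \<le> C"
proof -
  obtain D where D0: "D 0 = u" and D: "\<And>n x. (D n has_vector_derivative D (Suc n) x) (at x)"
    using assms(1) by (auto simp: smooth_def)
  have cont: "continuous_on S (D n)" for n S
    using D by (intro continuous_at_imp_continuous_on) (auto dest: has_vector_derivative_continuous)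
  have per: "periodic (D n)" for n
  proof (induction n)
    case (Suc n)
    have "D (Suc n) (x + 2 * pi) = D (Suc n) x" for x
    proof -
      have "((D n \<circ> (\<lambda>x. x + 2 * pi)) has_vector_derivative 1 *\<^sub>R D (Suc n) (x + 2 * pi)) (at x)"
        by (intro vector_diff_chain_at D) (auto intro!: derivative_eq_intros)
      moreover have "D n \<circ> (\<lambda>x. x + 2 * pi) = D n"
        using Suc by (auto simp: periodic_def)
      ultimately show ?thesis
        using vector_derivative_unique_at[OF D] by auto
    qed
    then show ?case by (simp add: periodic_def)
  qed (use D0 assms in simp)
  have "\<exists>C. \<forall>k. (1 + \<bar>real_of_int k\<bar>) ^ n * cmod (fourier (D i) k) \<le> C" for i
  proof (induction n arbitrary: i)
    case 0
    have "bounded (D i ` {-pi..pi})"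
      by (intro compact_imp_bounded compact_continuous_image cont) auto
    then show ?case
      using fourier_le[OF cont] by (fastforce simp: bounded_iff)
  next
    case (Suc n)
    obtain C C' where "\<forall>k. (1 + \<bar>real_of_int k\<bar>) ^ n * cmod (fourier (D i) k) \<le> C"
      "\<forall>k. (1 + \<bar>real_of_int k\<bar>) ^ n * cmod (fourier (D (Suc i)) k) \<le> C'"
      using Suc by meson
    moreover have "cmod (fourier (D (Suc i)) k) = \<bar>real_of_int k\<bar> * cmod (fourier (D i) k)" for k
      using fourier_deriv[OF D cont per] by (simp add: norm_mult)
    ultimately have "(1 + \<bar>real_of_int k\<bar>) ^ Suc n * cmod (fourier (D i) k) \<le> C + C'" for k
      using add_mono[of "(1 + \<bar>real_of_int k\<bar>) ^ n * cmod (fourier (D i) k)" C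
         "(1 + \<bar>real_of_int k\<bar>) ^ n * cmod (fourier (D (Suc i)) k)" C']
      by (simp add: algebra_simps)
    then show ?case by blast
  qed
  then show ?thesis using D0 by metis
qed

text \<open>Decay with two spare powers of \<open>1 + |k|\<close> leaves a summable majorant
  independent of \<open>N\<close>.\<close>

lemma smooth_wnorm_fourier_bounded:
  assumes "smooth u" "periodic u"
  shows "\<exists>C. \<forall>N. wnorm m N (fourier u) \<le> C"
proof -
  obtain C where C: "(1 + \<bar>real_of_int k\<bar>) ^ (m + 2) * cmod (fourier u k) \<le> C" for k
    using smooth_fourier_decay[OF assms, of "m + 2"] by blast
  have C0: "C \<ge> 0" using order_trans[OF _ C[of 0]] by simp
  \<comment> \<open>Written with \<open>2 * 1\<close> to match \<open>summable_on_int_powr\<close>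
    for exponent \<open>s = 1\<close>.\<close>
  let ?f = "\<lambda>k::int. 1 / (1 + \<bar>real_of_int k\<bar> powr (2 * 1))"
  have "wnorm m N (fourier u) \<le> C * (\<Sum>\<^sub>\<infinity>k. ?f k)" for N
  proof -
    have "wnorm m N (fourier u) \<le> (\<Sum>k\<in>freqs N. C * ?f k)"
      unfolding wnorm_def
    proof (rule sum_mono)
      fix k
      let ?x = "1 + \<bar>real_of_int k\<bar>"
      have p: "\<bar>real_of_int k\<bar> powr (2 * 1) = \<bar>real_of_int k\<bar>\<^sup>2"
        by (cases "k = 0") auto
      have "?x ^ m * cmod (fourier u k) \<le> C / ?x\<^sup>2"
        using C[of k] unfolding power_add by (simp add: pos_le_divide_eq mult_ac)
      also have "\<dots> \<le> C / (1 + \<bar>real_of_int k\<bar> powr (2 * 1))"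
        unfolding p using C0 by (intro divide_left_mono) (auto simp: power2_sum add_pos_nonneg)
      finally show "?x ^ m * cmod (fourier u k) \<le> C * ?f k" by simp
    qed
    also have "\<dots> \<le> C * (\<Sum>\<^sub>\<infinity>k. ?f k)"
      unfolding sum_distrib_left[symmetric] using C0
      by (intro mult_left_mono finite_sum_le_infsum summable_on_int_powr) auto
    finally show ?thesis .
  qed
  then show ?thesis by blast
qed

section \<open>Uniform bounds for the Galerkin solutions and their time derivatives\<close>

lemma galerkin_bounded_family:
  assumes "1/2 < s" "s \<le> 1" "smooth u0" "periodic u0"
    and sol: "\<And>N. N \<in> A \<Longrightarrow> galerkin_solution s T N u0 (uN N)"
    and small: "\<And>N. N \<in> A \<Longrightarrow> (C_infty s)\<^sup>2 * mass (uN N 0) < 1"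
  shows "bounded_family T A (\<lambda>N t. fourier (uN N t))"
  unfolding bounded_family_def
proof
  fix m
  \<comment> \<open>\<open>C2\<close> controls the initial mass and kinetic energy and hence
    \<open>B\<close>; \<open>Cm\<close> controls the initial value in Gronwall's inequality. Neither
    depends on \<open>N\<close>.\<close>
  obtain C2 where C2: "wnorm 2 N (fourier u0) \<le> C2" for N
    using smooth_wnorm_fourier_bounded[OF assms(3,4)] by blast
  obtain Cm where Cm: "wnorm m N (fourier u0) \<le> Cm" for N
    using smooth_wnorm_fourier_bounded[OF assms(3,4)] by blast
  define B where "B = 3 * (C_infty s)\<^sup>2 * C2\<^sup>2"
  have "wnorm m N (fourier (uN N t)) \<le> exp (3 * 3 ^ m * B * T) * (Cm + 1)"
    if N: "N \<in> A" and t: "t \<in> {0..T}" for N t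
  proof -
    let ?a = "\<lambda>t. fourier (uN N t)"
    have flow: "coeff_flow s T N ?a"
      using galerkin_solution_coeffs[OF sol[OF N]] by (simp add: coeff_flow_def)
    have init: "uN N 0 = trig_sum N (fourier u0)"
      using sol[OF N] by (simp add: galerkin_solution_def trig_proj_def trig_sum_def fun_eq_iff)
    then have winit: "wnorm i N (?a 0) = wnorm i N (fourier u0)" for i
      by (intro wnorm_cong) (simp add: fourier_trig_sum)
    have "mass (uN N 0) = pi * l2sq N (?a 0)"
      unfolding l2sq_def init by (simp add: mass_trig_sum fourier_trig_sum)
    then have "(C_infty s)\<^sup>2 * (pi * l2sq N (?a 0)) < 1"
      using small[OF N] by simp
    \<comment> \<open>\<open>mass\<close> is \<open>pi\<close> times \<open>l2sq\<close>, and
      \<open>pi >= 1\<close>, so smallness of the mass passes to \<open>l2sq\<close>.\<close>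
    moreover have "1 * l2sq N (?a 0) \<le> pi * l2sq N (?a 0)"
      using pi_gt3 by (intro mult_right_mono) (auto simp: l2sq_def sum_nonneg)
    then have "(C_infty s)\<^sup>2 * (1 * l2sq N (?a 0)) \<le> (C_infty s)\<^sup>2 * (pi * l2sq N (?a 0))"
      by (intro mult_left_mono) auto
    ultimately have small': "(C_infty s)\<^sup>2 * l2sq N (?a 0) \<le> 1" by simp
    have "(wnorm 0 N (?a \<tau>))\<^sup>2 \<le> B" if "\<tau> \<in> {0..T}" for \<tau>
    proof -
      have "(wnorm 0 N (?a \<tau>))\<^sup>2 \<le> 3 * (C_infty s)\<^sup>2 * (l2sq N (?a 0) + kinetic s N (?a 0))"
        by (rule wnorm_0_bounded[OF assms(1) flow that small'])
      also have "\<dots> \<le> 3 * (C_infty s)\<^sup>2 * (wnorm 2 N (?a 0))\<^sup>2"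
        using assms(1,2) by (intro mult_left_mono l2sq_add_kinetic_le) auto
      also have "\<dots> \<le> B"
        unfolding B_def winit by (intro mult_left_mono power_mono C2 wnorm_nonneg) auto
      finally show ?thesis .
    qed
    from wnorm_gronwall[OF flow t this, where m = m]
    have "wnorm m N (?a t) \<le> exp (3 * 3 ^ m * B * T) * (wnorm m N (?a 0) + 1)" .
    also have "\<dots> \<le> exp (3 * 3 ^ m * B * T) * (Cm + 1)"
      unfolding winit by (intro mult_left_mono add_right_mono Cm) auto
    finally show ?thesis .
  qed
  then show "\<exists>C. \<forall>N\<in>A. \<forall>t\<in>{0..T}. wnorm m N (fourier (uN N t)) \<le> C" by blast
qed

theorem proposition2p2:
  fixes s T \<mu> :: real
    and j l :: nat
    and u0 :: "real \<Rightarrow> complex"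
    and u :: "real \<Rightarrow> real \<Rightarrow> complex"
    and uN :: "nat \<Rightarrow> real \<Rightarrow> real \<Rightarrow> complex"
  assumes "T > 0"
    and "1/2 < s" and "s \<le> 1"
    and "smooth u0" and "periodic u0"
    and "\<And>N. N \<ge> 1 \<Longrightarrow> galerkin_solution s T N u0 (uN N)"
    and "fNLS_solution s T u0 u"
    and "\<mu> > s"
    and "\<And>t. t \<in> {0..T} \<Longrightarrow> u t \<in> Sobolev \<mu>"
    and "bdd_above ((\<lambda>t. sobolev_norm \<mu> (u t)) ` {0..T})"
    and "\<mu> \<ge> max 2 (2 * s * real j + real l)"
  shows "\<exists>C. \<forall>N\<ge>1.
           1 - (C_infty s)\<^sup>2 * mass (uN N 0) > 0 \<longrightarrow>
           mass (uN N 0) / 2 + energy s (uN N 0) \<ge> 0 \<longrightarrow>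
           (\<forall>t\<in>{0..T}. (time_deriv T ^^ j) (uN N) t \<in> Sobolev (real l) \<and>
                        sobolev_norm (real l) ((time_deriv T ^^ j) (uN N) t) \<le> C)"
proof -
  \<comment> \<open>Collecting the admissible \<open>N\<close> in a set lets one constant be chosen
    for all of them before any particular \<open>N\<close> is fixed.\<close>
  define A where "A = {N. N \<ge> 1 \<and> (C_infty s)\<^sup>2 * mass (uN N 0) < 1}"
  have sol: "galerkin_solution s T N u0 (uN N)" if "N \<in> A" for N
    using that assms(6) by (auto simp: A_def)
  have "bounded_family T A (\<lambda>N t. fourier (uN N t))"
    by (rule galerkin_bounded_family[OF assms(2-5) sol]) (simp_all add: A_def)
  then have "bounded_derivs T A j (\<lambda>N t. fourier (uN N t))"
    using assms(2,3) galerkin_solution_coeffs[OF sol]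
    by (intro bounded_derivs_flow[of s]) (auto simp: coeff_flow_def)
  moreover have "uN N t = trig_sum N (fourier (uN N t))" if "N \<in> A" "t \<in> {0..T}" for N t
    using sol[OF that(1)] that(2) by (intro trig_space_eq) (auto simp: galerkin_solution_def)
  ultimately obtain f where f: "bounded_family T A f"
    "\<forall>N\<in>A. \<forall>t\<in>{0..T}. (time_deriv T ^^ j) (uN N) t = trig_sum N (f N t)"
    using time_deriv_funpow[OF assms(1), of A j "\<lambda>N t. fourier (uN N t)" uN] by blast
  obtain C where C: "\<forall>N\<in>A. \<forall>t\<in>{0..T}. wnorm l N (f N t) \<le> C"
    using f(1) unfolding bounded_family_def by blast
  have "(time_deriv T ^^ j) (uN N) t \<in> Sobolev (real l) \<and>
        sobolev_norm (real l) ((time_deriv T ^^ j) (uN N) t) \<le> C" if "N \<in> A" "t \<in> {0..T}" for N t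
    using that f(2) C trig_sum_Sobolev(1) order_trans[OF trig_sum_Sobolev(2)] by metis
  then show ?thesis
    by (intro exI[of _ C]) (auto simp: A_def)
qed

end
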